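(* Let $\alpha>0$ and let the divisor $X=\{(\lambda,m_\lambda)\}_{\lambda\in\Lambda}$ satisfy $\lim_{|\lambda|\to\infty}m_\lambda=+\infty$. Then $X$ cannot be simultaneously interpolating and sampling for $\mathcal F_\alpha^2$.
   Context: For $\alpha>0$, the Fock space is $$\mathcal F_\alpha^2=\Bigl\{f\in \operatorname{Hol}(\mathbb C): \|f\|_2^2:=\frac{\alpha}{\pi}\int_{\mathbb C}|f(z)|^2e^{-\alpha|z|^2}\,dm(z)<\infty\Bigr\},$$ where $\operatorname{Hol}(\mathbb C)$ is the set of entire functions and $m$ is planar Lebesgue measure. It is a Hilbert space with inner product $\langle f,g\rangle=\frac{\alpha}{\pi}\int_{\mathbb C} f(z)\overline{g(z)}e^{-\alpha|z|^2}\,dm(z)$, and $e_k(z)=\frac{\sqrt{\alpha^k}}{\sqrt{k!}}z^k$, $k\ge 0$, is an orthonormal basis of it. For $z\in\mathbb C$, the translation $T_z$, acting isometrically on $\mathcal F_\alpha^2$, is $T_zf(\zeta)=e^{\alpha\bar z\zeta-\frac{\alpha}{2}|z|^2}f(\zeta-z)$. A divisor $X=\{(\lambda,m_\lambda)\}_{\lambda\in\Lambda}$ consists of a sequence $\Lambda$ of (distinct) points in $\mathbb C$ and, for each $\lambda\in\Lambda$, a positive integer $m_\lambda$ (the multiplicity associated with $\lambda$). The condition $\lim_{|\lambda|\to\infty}m_\lambda=+\infty$ means that for every $M>0$ there is $R>0$ such that $m_\lambda>M$ for all $\lambda\in\Lambda$ with $|\lambda|>R$. $X$ is called sampling for $\mathcal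 F_\alpha^2$ if $$\|f\|_2^2\asymp\sum_{\lambda\in\Lambda}\sum_{k=0}^{m_\lambda-1}|\langle f,T_\lambda e_k\rangle|^2,\qquad f\in\mathcal F_\alpha^2,$$ i.e. each side is bounded by a positive constant times the other, with constants independent of $f$. $X$ is called interpolating for $\mathcal F_\alpha^2$ if for every family of complex numbers $v=\{v_\lambda^{(k)}\}_{\lambda\in\Lambda,\;0\le k<m_\lambda}$ with $\sum_{\lambda\in\Lambda}\sum_{k=0}^{m_\lambda-1}|v_\lambda^{(k)}|^2<\infty$ there exists $f\in\mathcal F_\alpha^2$ such that $\langle f,T_\lambda e_k\rangle=v_\lambda^{(k)}$ for all $\lambda\in\Lambda$ and $0\le k<m_\lambda$. *)

theory Defs
  imports "HOL-Complex_Analysis.Complex_Analysis"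
begin

definition fock_space :: "real \<Rightarrow> (complex \<Rightarrow> complex) set" where
  "fock_space \<alpha> = {f. f holomorphic_on UNIV \<and>
     integrable lborel (\<lambda>z::complex. (cmod (f z))\<^sup>2 * exp (- \<alpha> * (cmod z)\<^sup>2))}"

definition fock_norm_sq :: "real \<Rightarrow> (complex \<Rightarrow> complex) \<Rightarrow> real" where
  "fock_norm_sq \<alpha> f = \<alpha> / pi * (LINT z|lborel. (cmod (f z))\<^sup>2 * exp (- \<alpha> * (cmod z)\<^sup>2))"

definition fock_inner :: "real \<Rightarrow> (complex \<Rightarrow> complex) \<Rightarrow> (complex \<Rightarrow> complex) \<Rightarrow> complex" where
  "fock_inner \<alpha> f g = of_real (\<alpha> / pi) *
     (LINT z|lborel. f z * cnj (g z) * of_real (exp (- \<alpha> * (cmod z)\<^sup>2)))"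

definition fock_basis :: "real \<Rightarrow> nat \<Rightarrow> complex \<Rightarrow> complex" where
  "fock_basis \<alpha> k z = of_real (sqrt (\<alpha> ^ k) / sqrt (fact k)) * z ^ k"

definition fock_translation :: "real \<Rightarrow> complex \<Rightarrow> (complex \<Rightarrow> complex) \<Rightarrow> complex \<Rightarrow> complex" where
  "fock_translation \<alpha> z f \<zeta> =
     exp (of_real \<alpha> * cnj z * \<zeta> - of_real (\<alpha> / 2 * (cmod z)\<^sup>2)) * f (\<zeta> - z)"

text \<open>A divisor is given by the set \<open>\<Lambda>\<close> of its (distinct) points, finite or countably infinite,
  together with a multiplicity function \<open>m\<close>, of which only the values on \<open>\<Lambda>\<close> matter.\<close>

definition divisor :: "complex set \<Rightarrow> (complex \<Rightarrow> nat) \<Rightarrow> bool" where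
  "divisor \<Lambda> m \<longleftrightarrow> countable \<Lambda> \<and> (\<forall>l\<in>\<Lambda>. m l > 0)"

definition multiplicities_tend_to_infinity :: "complex set \<Rightarrow> (complex \<Rightarrow> nat) \<Rightarrow> bool" where
  "multiplicities_tend_to_infinity \<Lambda> m \<longleftrightarrow>
     (\<forall>M::real. M > 0 \<longrightarrow> (\<exists>R::real. R > 0 \<and> (\<forall>l\<in>\<Lambda>. cmod l > R \<longrightarrow> real (m l) > M)))"

text \<open>Since \<open>infsum\<close> is 0 for divergent series, finiteness of the sum, which is part of
  the upper sampling inequality, is stated separately.\<close>

definition sampling :: "real \<Rightarrow> complex set \<Rightarrow> (complex \<Rightarrow> nat) \<Rightarrow> bool" where
  "sampling \<alpha> \<Lambda> m \<longleftrightarrow>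
     (\<exists>A::real. \<exists>B::real. A > 0 \<and> B > 0 \<and> (\<forall>f\<in>fock_space \<alpha>.
        (let S = (\<lambda>l. \<Sum>k<m l.
                   (cmod (fock_inner \<alpha> f (fock_translation \<alpha> l (fock_basis \<alpha> k))))\<^sup>2)
         in S summable_on \<Lambda> \<and>
            A * fock_norm_sq \<alpha> f \<le> infsum S \<Lambda> \<and>
            infsum S \<Lambda> \<le> B * fock_norm_sq \<alpha> f)))"

definition interpolating :: "real \<Rightarrow> complex set \<Rightarrow> (complex \<Rightarrow> nat) \<Rightarrow> bool" where
  "interpolating \<alpha> \<Lambda> m \<longleftrightarrow>
     (\<forall>v :: complex \<Rightarrow> nat \<Rightarrow> complex.
        (\<lambda>l. \<Sum>k<m l. (cmod (v l k))\<^sup>2) summable_on \<Lambda> \<longrightarrow>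
        (\<exists>f\<in>fock_space \<alpha>. \<forall>l\<in>\<Lambda>. \<forall>k<m l.
           fock_inner \<alpha> f (fock_translation \<alpha> l (fock_basis \<alpha> k)) = v l k))"

end

theory Submission
  imports Defs "HOL-Probability.Characteristic_Functions"
begin

text \<open>
  The squared moduli of the coefficients of the normalised coherent state at \<open>z\<close> in the basis centred at a node
  \<open>l\<close> are the weights of the Poisson distribution with mean \<open>\<alpha> |z - l|\<^sup>2\<close>
  (\<open>coherent_state_inner_translated_basis\<close>). The energy that the first \<open>m\<close> coefficients capture is therefore close to \<open>1\<close>
  when \<open>z\<close> lies well inside the disc of radius \<open>\<surd>(m / \<alpha>)\<close> about \<open>l\<close>, and it decays like a
  Gaussian in the distance when \<open>z\<close> lies outside; both follow from one comparison of Poisson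
  weights (\<open>poisson_weight_compare\<close>).

  Suppose that a divisor is both sampling and interpolating, and attach to each node the disc whose radius is
  \<open>\<surd>(m / \<alpha>)\<close>. The sampling inequalities for coherent states force every point to lie within a bounded
  distance of some disc, so the discs cover the plane once their radii are increased by a constant
  (\<open>sampling_imp_cover\<close>). If a point lay deep in two discs, its coherent state would almost
  belong to the spans attached to two different nodes, which are uniformly independent when the divisor
  is both sampling and interpolating; so the discs become disjoint once their radii are decreased by a
  constant (\<open>complete_interpolating_imp_disjoint\<close>).

  These two facts are incompatible with radii that tend to infinity, because large disjoint discs that
  almost touch leave gaps in between whose size is comparable to the radii
  (\<open>disjoint_large_discs_leave_gaps\<close>).
\<close>

section \<open>Gaussian integrals in the plane\<close>

lemma lborel_complex_eq_distr_pair: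
  "(lborel :: complex measure) =
     distr (lborel \<Otimes>\<^sub>M lborel) borel (\<lambda>(x::real, y::real). Complex x y)"
proof (rule lborel_eqI)
  have [measurable]: "(\<lambda>(x::real, y::real). Complex x y) \<in> borel_measurable (lborel \<Otimes>\<^sub>M lborel)"
    by (simp add: Complex_eq case_prod_beta) 
  fix l u :: complex
  assume "\<And>b. b \<in> Basis \<Longrightarrow> l \<bullet> b \<le> u \<bullet> b"
  from this[of 1] this[of \<i>] have le: "Re l \<le> Re u" "Im l \<le> Im u"
    by (auto simp: Basis_complex_def inner_complex_def)
  have "(\<lambda>(x::real, y::real). Complex x y) -` box l u \<inter> space (lborel \<Otimes>\<^sub>M lborel)
      = {Re l<..<Re u} \<times> {Im l<..<Im u}"
    by (auto simp: box_def Basis_complex_def inner_complex_def space_pair_measure)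
  hence "emeasure (distr (lborel \<Otimes>\<^sub>M lborel) borel (\<lambda>(x::real, y::real). Complex x y)) (box l u)
      = emeasure (lborel \<Otimes>\<^sub>M lborel) ({Re l<..<Re u} \<times> {Im l<..<Im u})"
    by (subst emeasure_distr) auto
  also have "\<dots> = ennreal (Re u - Re l) * ennreal (Im u - Im l)"
    using le by (subst lborel.emeasure_pair_measure_Times) auto
  also have "\<dots> = (\<Prod>b\<in>Basis. (u - l) \<bullet> b)"
    using le by (simp add: Basis_complex_def inner_complex_def ennreal_mult)
  finally show "emeasure (distr (lborel \<Otimes>\<^sub>M lborel) borel (\<lambda>(x, y). Complex x y)) (box l u)
     = (\<Prod>b\<in>Basis. (u - l) \<bullet> b)" .
qed simp

text \<open>Fubini for separated variables, in the form that reduces planar Gaussian integrals to the line.\<close>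

lemma lborel_complex_product:
  fixes f g :: "real \<Rightarrow> 'a :: {real_normed_field, banach, second_countable_topology}"
  assumes f: "integrable lborel f" and g: "integrable lborel g"
  shows "integrable (lborel :: complex measure) (\<lambda>z. f (Re z) * g (Im z))" (is ?int)
    and "(LINT z|(lborel :: complex measure). f (Re z) * g (Im z)) = (LINT x|lborel. f x) * (LINT y|lborel. g y)"
proof -
  have [measurable]: "f \<in> borel_measurable borel" "g \<in> borel_measurable borel"
    using f g by auto
  have [measurable]: "(\<lambda>(x::real, y::real). Complex x y) \<in> borel_measurable (lborel \<Otimes>\<^sub>M lborel)"
    by (simp add: Complex_eq case_prod_beta) 
  have prod: "integrable (lborel \<Otimes>\<^sub>M lborel) (\<lambda>(x, y). f x * g y)"
    using f g by (intro lborel_pair.Fubini_integrable) (auto simp: norm_mult)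
  show ?int
    unfolding lborel_complex_eq_distr_pair using prod
    by (subst integrable_distr_eq) (auto simp: case_prod_beta')
  have "(LINT z|(lborel :: complex measure). f (Re z) * g (Im z))
      = (LINT p|(lborel \<Otimes>\<^sub>M lborel). f (fst p) * g (snd p))"
    unfolding lborel_complex_eq_distr_pair
    by (subst integral_distr) (auto simp: case_prod_beta')
  also have "\<dots> = (LINT x|lborel. LINT y|lborel. f x * g y)"
    using prod by (subst lborel_pair.integral_fst' [symmetric]) (auto simp: case_prod_beta')
  also have "\<dots> = (LINT x|lborel. f x) * (LINT y|lborel. g y)"
    by simp
  finally show "(LINT z|(lborel :: complex measure). f (Re z) * g (Im z)) = (LINT x|lborel. f x) * (LINT y|lborel. g y)" .
qed

text \<open>Completing the square removes the real part of \<open>c\<close> by a real shift of the variable; what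
  remains is the characteristic function of the normal distribution, so no contour has to be moved.\<close>

lemma gaussian_integral_complex_exponent:
  fixes c :: complex and \<alpha> :: real
  assumes "\<alpha> > 0"
  shows "integrable lborel (\<lambda>x::real. exp (c * of_real x - of_real (\<alpha> * x\<^sup>2)))" (is ?int)
    and "(LINT x|lborel. exp (c * of_real x - of_real (\<alpha> * x\<^sup>2)))
       = of_real (sqrt (pi / \<alpha>)) * exp (c\<^sup>2 / of_real (4 * \<alpha>))"
proof -
  define b where "b = sqrt (2 * \<alpha>)"
  have b: "b > 0" "b\<^sup>2 = 2 * \<alpha>" using assms by (auto simp: b_def)
  define s t where "s = Re c / (2 * \<alpha>)" and "t = Im c / b"
  have int0: "integrable lborel (\<lambda>y. iexp (t * y) * of_real (std_normal_density y))"
    by (rule Bochner_Integration.integrable_bound[OF integrable_normal_moment[of 1 0 0]]) (auto simp: norm_mult)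
  have char: "(LINT y|lborel. iexp (t * y) * of_real (std_normal_density y)) = of_real (exp (- (t\<^sup>2) / 2))"
  proof -
    have "char std_normal_distribution t = (LINT y|lborel. std_normal_density y *\<^sub>R iexp (t * y))"
      unfolding char_def by (subst integral_density) auto
    thus ?thesis using fun_cong[OF char_std_normal_distribution, of t]
      by (simp add: scaleR_conv_of_real mult.commute)
  qed
  \<comment> \<open>The substitution \<open>y = b (x - s)\<close> centres the Gaussian at the real part \<open>s\<close> of the critical point
    and scales it to variance one.\<close>
  have key: "exp (c * of_real x - of_real (\<alpha> * x\<^sup>2))
      = of_real (sqrt (2 * pi)) * exp (c * of_real s - of_real (\<alpha> * s\<^sup>2)) * 
        (iexp (t * (- b * s + b * x)) * of_real (std_normal_density (- b * s + b * x)))" for x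
  proof -
    have e1: "c * of_real x - of_real (\<alpha> * x\<^sup>2) = (c * of_real s - of_real (\<alpha> * s\<^sup>2)) +
        (\<i> * of_real (t * (- b * s + b * x)) + of_real (- (- b * s + b * x)\<^sup>2 / 2))"
    proof -
      have "(- b * s + b * x)\<^sup>2 = b\<^sup>2 * (x - s)\<^sup>2" by (simp add: power2_eq_square algebra_simps)
      hence sq: "(- b * s + b * x)\<^sup>2 / 2 = \<alpha> * (x - s)\<^sup>2" using b by simp
      have tb: "t * (- b * s + b * x) = Im c * (x - s)" using b by (simp add: t_def field_simps)
      have re: "Re c = 2 * \<alpha> * s" using assms by (simp add: s_def)
      show ?thesis unfolding minus_divide_left[symmetric] sq tb
        by (rule complex_eqI) (auto simp: re power2_eq_square algebra_simps)
    qed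
    have e2: "of_real (std_normal_density (- b * s + b * x)) * complex_of_real (sqrt (2 * pi))
        = exp (of_real (- (- b * s + b * x)\<^sup>2 / 2))"
      unfolding of_real_mult[symmetric] exp_of_real of_real_eq_iff
      by (simp add: std_normal_density_def)
    show ?thesis
      unfolding e1 exp_add e2[symmetric] by (simp add: mult_ac)
  qed
  have key': "(\<lambda>x. exp (c * of_real x - of_real (\<alpha> * x\<^sup>2)))
     = (\<lambda>x. of_real (sqrt (2 * pi)) * exp (c * of_real s - of_real (\<alpha> * s\<^sup>2)) * 
        (iexp (t * (- b * s + b * x)) * of_real (std_normal_density (- b * s + b * x))))"
    by (intro ext key)
  show ?int
    unfolding key' using lborel_integrable_real_affine[OF int0, of b "- b * s"] b
    by (intro integrable_mult_right) simp
  have "(LINT x|lborel. exp (c * of_real x - of_real (\<alpha> * x\<^sup>2)))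
     = of_real (sqrt (2 * pi)) * exp (c * of_real s - of_real (\<alpha> * s\<^sup>2)) *
       (of_real (exp (- (t\<^sup>2) / 2)) / of_real b)"
    unfolding key' char[symmetric]
    using b by (subst (2) lborel_integral_real_affine[of b _ "- b * s"]) (simp_all add: scaleR_conv_of_real)
  also have "\<dots> = of_real (sqrt (pi / \<alpha>)) * exp (c\<^sup>2 / of_real (4 * \<alpha>))"
  proof -
    have r: "sqrt (2 * pi) / b = sqrt (pi / \<alpha>)"
      by (simp add: b_def real_sqrt_divide real_sqrt_mult)
    have re: "Re c = 2 * \<alpha> * s" using assms by (simp add: s_def)
    have t2: "t\<^sup>2 = (Im c)\<^sup>2 / (2 * \<alpha>)" by (simp add: t_def power_divide b)
    have "c\<^sup>2 = of_real (4 * \<alpha>) * (c * of_real s - of_real (\<alpha> * s\<^sup>2) + of_real (- (t\<^sup>2) / 2))"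
      unfolding t2 using assms
      by (intro complex_eqI) (auto simp: re power2_eq_square field_simps)
    hence e: "c\<^sup>2 / of_real (4 * \<alpha>) = c * of_real s - of_real (\<alpha> * s\<^sup>2) + of_real (- (t\<^sup>2) / 2)"
      using assms by (subst nonzero_divide_eq_eq) (simp_all add: mult.commute)
    show ?thesis unfolding e exp_add r[symmetric] exp_of_real by simp
  qed
  finally show "(LINT x|lborel. exp (c * of_real x - of_real (\<alpha> * x\<^sup>2)))
       = of_real (sqrt (pi / \<alpha>)) * exp (c\<^sup>2 / of_real (4 * \<alpha>))" .
qed

text \<open>The generating function of all Gaussian moments: expanding both sides in \<open>a\<close> and \<open>b\<close> gives
  the orthogonality of the monomials and their inner products with exponentials.\<close>

lemma gaussian_integral_plane:
  fixes a b :: complex and \<alpha> :: real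
  assumes "\<alpha> > 0"
  shows "integrable lborel (\<lambda>z. exp (a * z + b * cnj z) * of_real (exp (- \<alpha> * (cmod z)\<^sup>2)))"
    and "(LINT z|lborel. exp (a * z + b * cnj z) * of_real (exp (- \<alpha> * (cmod z)\<^sup>2)))
       = of_real (pi / \<alpha>) * exp (a * b / of_real \<alpha>)"
proof -
  let ?f = "\<lambda>x::real. exp ((a + b) * of_real x - of_real (\<alpha> * x\<^sup>2))"
  let ?g = "\<lambda>y::real. exp ((\<i> * (a - b)) * of_real y - of_real (\<alpha> * y\<^sup>2))"
  have eq: "(\<lambda>z. exp (a * z + b * cnj z) * of_real (exp (- \<alpha> * (cmod z)\<^sup>2)))
      = (\<lambda>z. ?f (Re z) * ?g (Im z))"
  proof
    fix z
    have "a * z + b * cnj z + of_real (- \<alpha> * (cmod z)\<^sup>2)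
      = ((a + b) * of_real (Re z) - of_real (\<alpha> * (Re z)\<^sup>2)) +
        ((\<i> * (a - b)) * of_real (Im z) - of_real (\<alpha> * (Im z)\<^sup>2))"
      by (rule complex_eqI) (auto simp: cmod_power2 algebra_simps)
    thus "exp (a * z + b * cnj z) * of_real (exp (- \<alpha> * (cmod z)\<^sup>2)) = ?f (Re z) * ?g (Im z)"
      unfolding exp_of_real[symmetric] exp_add[symmetric] by simp
  qed
  note f = gaussian_integral_complex_exponent[OF assms, of "a + b"]
  note g = gaussian_integral_complex_exponent[OF assms, of "\<i> * (a - b)"]
  show "integrable lborel (\<lambda>z. exp (a * z + b * cnj z) * of_real (exp (- \<alpha> * (cmod z)\<^sup>2)))"
    unfolding eq by (rule lborel_complex_product(1)[OF f(1) g(1)])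
  have "(a + b)\<^sup>2 + (\<i> * (a - b))\<^sup>2 = 4 * (a * b)"
    by (simp add: power2_eq_square algebra_simps)
  hence "(a + b)\<^sup>2 / of_real (4 * \<alpha>) + (\<i> * (a - b))\<^sup>2 / of_real (4 * \<alpha>) = a * b / of_real \<alpha>"
    unfolding add_divide_distrib[symmetric] by simp
  hence "exp (a * b / of_real \<alpha>) = exp ((a + b)\<^sup>2 / of_real (4 * \<alpha>)) * exp ((\<i> * (a - b))\<^sup>2 / of_real (4 * \<alpha>))"
    by (metis exp_add)
  moreover have "complex_of_real (pi / \<alpha>) = of_real (sqrt (pi / \<alpha>)) * of_real (sqrt (pi / \<alpha>))"
    unfolding of_real_mult[symmetric] using assms by simp
  ultimately show "(LINT z|lborel. exp (a * z + b * cnj z) * of_real (exp (- \<alpha> * (cmod z)\<^sup>2)))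
       = of_real (pi / \<alpha>) * exp (a * b / of_real \<alpha>)"
    unfolding eq lborel_complex_product(2)[OF f(1) g(1)] f(2) g(2) by simp
qed

text \<open>The linear exponent is absorbed by half of the quadratic one: \<open>c r \<le> c\<^sup>2 / (2 \<alpha>) + \<alpha> r\<^sup>2 / 2\<close>.\<close>

lemma integrable_gaussian_exp_growth:
  fixes g :: "complex \<Rightarrow> complex"
  assumes "\<alpha> > 0" and [measurable]: "g \<in> borel_measurable borel"
    and bound: "\<And>z. cmod (g z) \<le> K * exp (c * cmod z)"
  shows "integrable lborel (\<lambda>z. g z * of_real (exp (- \<alpha> * (cmod z)\<^sup>2)))"
proof (rule Bochner_Integration.integrable_bound)
  let ?h = "\<lambda>z. of_real (K * exp (c\<^sup>2 / (2 * \<alpha>))) * (exp (0 * z + 0 * cnj z) * of_real (exp (- (\<alpha> / 2) * (cmod z)\<^sup>2)))"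
  show "integrable lborel ?h"
    using gaussian_integral_plane(1)[of "\<alpha> / 2" 0 0] assms by (intro integrable_mult_right) simp
  have "cmod (g z * of_real (exp (- \<alpha> * (cmod z)\<^sup>2))) \<le> cmod (?h z)" for z
  proof -
    have "0 \<le> K * exp (c * cmod z)" by (rule order_trans[OF norm_ge_zero bound])
    hence K: "K \<ge> 0" by (simp add: zero_le_mult_iff)
    have "0 \<le> (c - \<alpha> * cmod z)\<^sup>2 / (2 * \<alpha>)" using assms by simp
    also have "\<dots> = c\<^sup>2 / (2 * \<alpha>) - \<alpha> / 2 * (cmod z)\<^sup>2 - (c * cmod z - \<alpha> * (cmod z)\<^sup>2)"
      using assms by (simp add: field_simps power2_eq_square)
    finally have e: "c * cmod z + - \<alpha> * (cmod z)\<^sup>2 \<le> c\<^sup>2 / (2 * \<alpha>) + - (\<alpha> / 2) * (cmod z)\<^sup>2"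
      by simp
    have "cmod (g z * of_real (exp (- \<alpha> * (cmod z)\<^sup>2))) \<le> K * exp (c * cmod z) * exp (- \<alpha> * (cmod z)\<^sup>2)"
      unfolding norm_mult using bound[of z] K by (intro mult_mono) auto
    also have "\<dots> = K * exp (c * cmod z + - \<alpha> * (cmod z)\<^sup>2)"
      by (simp only: exp_add mult.assoc)
    also have "\<dots> \<le> K * exp (c\<^sup>2 / (2 * \<alpha>) + - (\<alpha> / 2) * (cmod z)\<^sup>2)"
      using e K by (intro mult_left_mono) auto
    also have "\<dots> = cmod (?h z)" 
      using K by (subst exp_add) (simp add: norm_mult)
    finally show ?thesis .
  qed
  thus "AE z in lborel. cmod (g z * of_real (exp (- \<alpha> * (cmod z)\<^sup>2))) \<le> cmod (?h z)" by simp
qed simp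

lemma power_over_fact_le_exp:
  fixes x :: real
  assumes "x \<ge> 0"
  shows "x ^ n / fact n \<le> exp x"
  using sum_le_suminf[OF summable_exp_generic[of x], of "{n}"] assms
  by (simp add: exp_def divide_inverse mult.commute)

lemma power_le_exp_norm: "cmod (z ^ k) \<le> fact k * exp (cmod z)"
  using power_over_fact_le_exp[of "cmod z" k] by (simp add: norm_power field_simps)

text \<open>Expands one exponential under a Gaussian integral. It is applied with \<open>h\<close> the conjugation and
  with \<open>h\<close> the identity, to read off moments from \<open>gaussian_integral_plane\<close> one variable at a time.\<close>

lemma gaussian_integral_exp_series:
  fixes g h :: "complex \<Rightarrow> complex"
  assumes "\<alpha> > 0" and [measurable]: "g \<in> borel_measurable borel" "h \<in> borel_measurable borel"
    and bound: "\<And>z. cmod (g z) \<le> K * exp (c * cmod z)" and h: "\<And>z. cmod (h z) = cmod z"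
  shows "(\<lambda>n. (LINT z|lborel. h z ^ n * g z * of_real (exp (- \<alpha> * (cmod z)\<^sup>2))) / fact n * a ^ n) sums
           (LINT z|lborel. exp (a * h z) * g z * of_real (exp (- \<alpha> * (cmod z)\<^sup>2)))"
proof -
  define w where "w z = exp (- \<alpha> * (cmod z)\<^sup>2)" for z :: complex
  have [measurable]: "w \<in> borel_measurable borel" unfolding w_def by measurable
  have [measurable]: "(exp :: complex \<Rightarrow> complex) \<in> borel_measurable borel"
    by (intro borel_measurable_continuous_onI continuous_intros)
  define f where "f n z = (a * h z) ^ n /\<^sub>R fact n * (g z * of_real (w z))" for n z
  have exp_s: "(\<lambda>n. f n z) sums (exp (a * h z) * (g z * of_real (w z)))" for z
    unfolding f_def by (intro sums_mult2 exp_converges)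
  have norm_s: "(\<lambda>n. norm (f n z)) sums (exp (cmod a * cmod z) * (cmod (g z) * w z))" for z
  proof -
    have "norm (f n z) = (cmod a * cmod z) ^ n /\<^sub>R fact n * (cmod (g z) * w z)" for n
      by (simp add: f_def norm_mult norm_power h w_def)
    thus ?thesis by (simp only:) (intro sums_mult2 exp_converges)
  qed
  have K: "K \<ge> 0" using order_trans[OF norm_ge_zero bound[of 0]] by simp
  have int_f: "integrable lborel (f n)" for n
  proof -
    have "cmod ((a * h z) ^ n /\<^sub>R fact n * g z) \<le> K * exp ((c + cmod a) * cmod z)" for z
    proof -
      have "cmod ((a * h z) ^ n /\<^sub>R fact n * g z) = (cmod a * cmod z) ^ n / fact n * cmod (g z)"
        by (simp add: norm_mult norm_power h field_simps)
      also have "\<dots> \<le> exp (cmod a * cmod z) * (K * exp (c * cmod z))"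
        using power_over_fact_le_exp[of "cmod a * cmod z" n] bound[of z] by (intro mult_mono) auto
      finally show ?thesis by (simp add: exp_add algebra_simps)
    qed
    from integrable_gaussian_exp_growth[OF \<open>\<alpha> > 0\<close> _ this]
    show ?thesis unfolding f_def[abs_def] w_def[symmetric] by (simp add: mult.assoc)
  qed
  have int_sum: "integrable lborel (\<lambda>z. \<Sum>n. norm (f n z))"
  proof -
    have "cmod (exp (of_real (cmod a * cmod z)) * g z) \<le> K * exp ((c + cmod a) * cmod z)" for z
    proof -
      have "cmod (exp (of_real (cmod a * cmod z)) * g z) = exp (cmod a * cmod z) * cmod (g z)"
        by (simp add: norm_mult)
      also have "\<dots> \<le> exp (cmod a * cmod z) * (K * exp (c * cmod z))"
        using bound[of z] by (intro mult_left_mono) auto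
      finally show ?thesis by (simp add: exp_add algebra_simps)
    qed
    from integrable_gaussian_exp_growth[OF \<open>\<alpha> > 0\<close> _ this]
    have "integrable lborel (\<lambda>z. exp (of_real (cmod a * cmod z)) * g z * of_real (w z))"
      unfolding w_def by simp
    from integrable_norm[OF this] have "integrable lborel (\<lambda>z. exp (cmod a * cmod z) * (cmod (g z) * w z))"
      by (simp add: norm_mult w_def mult.assoc)
    thus ?thesis using norm_s by (simp add: sums_iff)
  qed
  have "summable (\<lambda>n. LINT z|lborel. norm (f n z))"
  proof (rule summableI_nonneg_bounded)
    fix N
    have "(\<Sum>n<N. (LINT z|lborel. norm (f n z))) = (LINT z|lborel. (\<Sum>n<N. norm (f n z)))"
      by (subst Bochner_Integration.integral_sum) (auto intro: int_f)
    also have "\<dots> \<le> (LINT z|lborel. (\<Sum>n. norm (f n z)))"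
      using norm_s by (intro integral_mono int_sum Bochner_Integration.integrable_sum integrable_norm int_f sum_le_suminf)
        (auto simp: sums_iff)
    finally show "(\<Sum>n<N. (LINT z|lborel. norm (f n z))) \<le> (LINT z|lborel. (\<Sum>n. norm (f n z)))" .
  qed simp
  hence "(\<lambda>n. integral\<^sup>L lborel (f n)) sums (LINT z|lborel. (\<Sum>n. f n z))"
    using norm_s by (intro sums_integral int_f) (auto simp: sums_iff)
  moreover have "integral\<^sup>L lborel (f n) = (LINT z|lborel. h z ^ n * g z * of_real (w z)) / fact n * a ^ n" for n
  proof -
    have "integral\<^sup>L lborel (f n) = (LINT z|lborel. (a ^ n / fact n) * (h z ^ n * g z * of_real (w z)))"
      by (intro Bochner_Integration.integral_cong refl)
         (simp add: f_def power_mult_distrib scaleR_conv_of_real field_simps)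
    thus ?thesis by (simp only: integral_mult_right_zero) simp
  qed
  moreover have "(\<Sum>n. f n z) = exp (a * h z) * g z * of_real (w z)" for z
    using sums_unique[OF exp_s[of z]] by (simp add: mult.assoc)
  ultimately show ?thesis by (simp add: w_def)
qed

lemma entire_power_series_unique:
  fixes u v :: "nat \<Rightarrow> complex"
  assumes u: "\<And>z. (\<lambda>n. u n * z ^ n) sums f z" and v: "\<And>z. (\<lambda>n. v n * z ^ n) sums f z"
  shows "u n = v n"
proof (cases "n = 0")
  case True
  have "u 0 = f 0" "v 0 = f 0"
    using sums_unique[OF u[of 0]] sums_unique[OF v[of 0]] by simp_all
  thus ?thesis using True by simp
next
  case False
  show ?thesis
  proof (rule ccontr)
    assume "u n \<noteq> v n"
    have diff: "(\<lambda>n. (u n - v n) * (z - 0) ^ n) sums 0" for z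
      using sums_diff[OF u[of z] v[of z]] by (simp add: algebra_simps)
    show False
    proof (rule powser_0_nonzero[of 1 0 "\<lambda>n. u n - v n" "\<lambda>_. 0" n])
      fix s :: real
      assume s: "0 < s" "\<And>z. z \<in> cball 0 s - {0 :: complex} \<Longrightarrow> (0::complex) \<noteq> 0"
      show False using s(2)[of "of_real s"] s(1) by simp
    qed (use False \<open>u n \<noteq> v n\<close> diff in auto)
  qed
qed

lemma exp_monomial_gaussian_integral:
  assumes "\<alpha> > 0"
  shows "(LINT z|lborel. cnj z ^ k * exp (a * z) * of_real (exp (- \<alpha> * (cmod z)\<^sup>2)))
     = of_real (pi / \<alpha>) * (a / of_real \<alpha>) ^ k" (is "?J k = _")
proof -
  have meas: "(\<lambda>z. exp (a * z)) \<in> borel_measurable borel" "cnj \<in> borel_measurable borel"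
    by (intro borel_measurable_continuous_onI continuous_intros)+
  have bound: "cmod (exp (a * z)) \<le> 1 * exp (cmod a * cmod z)" for z
    using norm_exp[of "a * z"] by (simp add: norm_mult)
  have 1: "(\<lambda>n. ?J n / fact n * b ^ n) sums (of_real (pi / \<alpha>) * exp (a * b / of_real \<alpha>))" for b
    using gaussian_integral_exp_series[OF assms meas bound, of b]
    unfolding gaussian_integral_plane(2)[OF assms, of a b, symmetric]
    by (simp add: exp_add mult_ac)
  have 2: "(\<lambda>n. of_real (pi / \<alpha>) * (a / of_real \<alpha>) ^ n / fact n * b ^ n)
      sums (of_real (pi / \<alpha>) * exp (a * b / of_real \<alpha>))" for b
    using sums_mult[OF exp_converges[of "a * b / of_real \<alpha>"], of "of_real (pi / \<alpha>)"]
    by (simp add: scaleR_conv_of_real power_mult_distrib power_divide field_simps)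
  have "?J k / fact k = of_real (pi / \<alpha>) * (a / of_real \<alpha>) ^ k / fact k"
    by (rule entire_power_series_unique[OF 1 2])
  thus ?thesis
    using fact_nonzero[where 'a = complex, of k] unfolding divide_cancel_right by blast
qed

lemma monomial_gaussian_integral:
  assumes "\<alpha> > 0"
  shows "(LINT z|lborel. z ^ n * cnj z ^ k * of_real (exp (- \<alpha> * (cmod z)\<^sup>2)))
     = (if n = k then of_real (pi / \<alpha> * (fact k / \<alpha> ^ k)) else 0)" (is "?M n = _")
proof -
  have meas: "(\<lambda>z. cnj z ^ k) \<in> borel_measurable borel" "(\<lambda>z. z) \<in> borel_measurable (borel :: complex measure)"
    by (intro borel_measurable_continuous_onI continuous_intros)+
  have bound: "cmod (cnj z ^ k) \<le> fact k * exp (1 * cmod z)" for z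
    using power_le_exp_norm[of "cnj z" k] by simp
  have 1: "(\<lambda>n. ?M n / fact n * a ^ n) sums (of_real (pi / \<alpha>) * (a / of_real \<alpha>) ^ k)" for a
    using gaussian_integral_exp_series[OF assms meas bound, of a]
    unfolding exp_monomial_gaussian_integral[OF assms, of k a, symmetric]
    by (simp add: mult_ac)
  have 2: "(\<lambda>n. (if n = k then of_real (pi / \<alpha>) / of_real \<alpha> ^ k else 0) * a ^ n)
      sums (of_real (pi / \<alpha>) * (a / of_real \<alpha>) ^ k)" for a :: complex
    using sums_single[of k "\<lambda>n. of_real (pi / \<alpha>) / of_real \<alpha> ^ n * a ^ n"]
    by (simp add: power_divide if_distrib[of "\<lambda>x. x * _"] cong: if_cong)
  have "?M n / fact n = (if n = k then of_real (pi / \<alpha>) / of_real \<alpha> ^ k else 0)"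
    by (rule entire_power_series_unique[OF 1 2])
  thus ?thesis by (auto simp: field_simps split: if_splits)
qed

section \<open>The Fock space as an inner product space\<close>

lemma
  fixes f :: "complex \<Rightarrow> 'a :: {banach, second_countable_topology}"
  assumes [measurable]: "f \<in> borel_measurable borel"
  shows integrable_lborel_shift: "integrable lborel (\<lambda>z. f (a + z)) \<longleftrightarrow> integrable lborel f"
    and integral_lborel_shift: "(LINT z|lborel. f (a + z)) = (LINT z|lborel. f z)"
proof -
  show "integrable lborel (\<lambda>z. f (a + z)) \<longleftrightarrow> integrable lborel f"
    by (subst (2) lborel_distr_plus[of a, symmetric], subst integrable_distr_eq) auto
  show "(LINT z|lborel. f (a + z)) = (LINT z|lborel. f z)"
    by (subst (2) lborel_distr_plus[of a, symmetric], subst integral_distr) auto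
qed

lemma fock_space_measurable:
  assumes "f \<in> fock_space \<alpha>"
  shows "f \<in> borel_measurable borel"
  using assms unfolding fock_space_def
  by (auto intro!: borel_measurable_continuous_onI holomorphic_on_imp_continuous_on)

lemma fock_space_scale:
  assumes "f \<in> fock_space \<alpha>"
  shows "(\<lambda>z. c * f z) \<in> fock_space \<alpha>"
proof -
  have "(\<lambda>z. (cmod (c * f z))\<^sup>2 * exp (- \<alpha> * (cmod z)\<^sup>2)) =
        (\<lambda>z. (cmod c)\<^sup>2 * ((cmod (f z))\<^sup>2 * exp (- \<alpha> * (cmod z)\<^sup>2)))"
    by (simp add: norm_mult power_mult_distrib mult.assoc)
  with assms show ?thesis unfolding fock_space_def by (auto intro!: holomorphic_intros)
qed

lemma norm_add_square_le: "(norm (x + y :: 'a :: real_normed_vector))\<^sup>2 \<le> 2 * (norm x)\<^sup>2 + 2 * (norm y)\<^sup>2"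
proof -
  have "(norm (x + y))\<^sup>2 \<le> (norm x + norm y)\<^sup>2" by (intro power_mono norm_triangle_ineq) auto
  also have "\<dots> \<le> 2 * (norm x)\<^sup>2 + 2 * (norm y)\<^sup>2"
    using zero_le_power2[of "norm x - norm y"] by (simp add: power2_eq_square algebra_simps)
  finally show ?thesis .
qed

lemma fock_space_integrable:
  assumes "f \<in> fock_space \<alpha>"
  shows "integrable lborel (\<lambda>z. (cmod (f z))\<^sup>2 * exp (- \<alpha> * (cmod z)\<^sup>2))"
  using assms by (simp add: fock_space_def)

lemma fock_space_add:
  assumes f: "f \<in> fock_space \<alpha>" and g: "g \<in> fock_space \<alpha>"
  shows "(\<lambda>z. f z + g z) \<in> fock_space \<alpha>"
proof -
  note [measurable] = fock_space_measurable[OF f] fock_space_measurable[OF g]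
  have "integrable lborel (\<lambda>z. (cmod (f z + g z))\<^sup>2 * exp (- \<alpha> * (cmod z)\<^sup>2))"
  proof (rule Bochner_Integration.integrable_bound)
    show "integrable lborel (\<lambda>z. 2 * ((cmod (f z))\<^sup>2 * exp (- \<alpha> * (cmod z)\<^sup>2)) + 2 * ((cmod (g z))\<^sup>2 * exp (- \<alpha> * (cmod z)\<^sup>2)))"
      using fock_space_integrable[OF f] fock_space_integrable[OF g] by auto
    have "(cmod (f z + g z))\<^sup>2 * exp (- \<alpha> * (cmod z)\<^sup>2)
       \<le> 2 * ((cmod (f z))\<^sup>2 * exp (- \<alpha> * (cmod z)\<^sup>2)) + 2 * ((cmod (g z))\<^sup>2 * exp (- \<alpha> * (cmod z)\<^sup>2))" for z
      using mult_right_mono[OF norm_add_square_le[of "f z" "g z"], of "exp (- \<alpha> * (cmod z)\<^sup>2)"]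
      by (simp add: algebra_simps)
    thus "AE z in lborel. norm ((cmod (f z + g z))\<^sup>2 * exp (- \<alpha> * (cmod z)\<^sup>2))
       \<le> norm (2 * ((cmod (f z))\<^sup>2 * exp (- \<alpha> * (cmod z)\<^sup>2)) + 2 * ((cmod (g z))\<^sup>2 * exp (- \<alpha> * (cmod z)\<^sup>2)))"
      by simp
  qed auto
  thus ?thesis using f g by (auto simp: fock_space_def intro!: holomorphic_intros)
qed

lemma fock_space_diff:
  assumes f: "f \<in> fock_space \<alpha>" and g: "g \<in> fock_space \<alpha>"
  shows "(\<lambda>z. f z - g z) \<in> fock_space \<alpha>"
  using fock_space_add[OF f fock_space_scale[OF g, of "-1"]] by simp

lemma fock_space_sum:
  assumes "\<And>k. k \<in> I \<Longrightarrow> f k \<in> fock_space \<alpha>"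
  shows "(\<lambda>z. \<Sum>k\<in>I. f k z) \<in> fock_space \<alpha>"
proof (cases "finite I")
  case True
  thus ?thesis using assms
  proof (induction I rule: finite_induct)
    case empty
    thus ?case by (simp add: fock_space_def)
  next
    case (insert x I)
    thus ?case by (simp add: fock_space_add)
  qed
qed (simp add: fock_space_def)

lemma fock_inner_integrable:
  assumes f: "f \<in> fock_space \<alpha>" and g: "g \<in> fock_space \<alpha>"
  shows "integrable lborel (\<lambda>z. f z * cnj (g z) * of_real (exp (- \<alpha> * (cmod z)\<^sup>2)))"
proof (rule Bochner_Integration.integrable_bound)
  note [measurable] = fock_space_measurable[OF f] fock_space_measurable[OF g]
  have [measurable]: "cnj \<in> borel_measurable borel"
    by (intro borel_measurable_continuous_onI continuous_intros)
  show "integrable lborel (\<lambda>z. (cmod (f z))\<^sup>2 * exp (- \<alpha> * (cmod z)\<^sup>2) + (cmod (g z))\<^sup>2 * exp (- \<alpha> * (cmod z)\<^sup>2))"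
    using fock_space_integrable[OF f] fock_space_integrable[OF g] by auto
  have "cmod (f z) * cmod (g z) \<le> (cmod (f z))\<^sup>2 + (cmod (g z))\<^sup>2" for z
    using zero_le_power2[of "cmod (f z) - cmod (g z)"] zero_le_power2[of "cmod (f z)"] zero_le_power2[of "cmod (g z)"]
    unfolding power2_diff by linarith
  from mult_right_mono[OF this, of "exp (- \<alpha> * (cmod _)\<^sup>2)"]
  show "AE z in lborel. norm (f z * cnj (g z) * of_real (exp (- \<alpha> * (cmod z)\<^sup>2)))
     \<le> norm ((cmod (f z))\<^sup>2 * exp (- \<alpha> * (cmod z)\<^sup>2) + (cmod (g z))\<^sup>2 * exp (- \<alpha> * (cmod z)\<^sup>2))"
    by (simp add: norm_mult distrib_right)
  show "(\<lambda>z. f z * cnj (g z) * of_real (exp (- \<alpha> * (cmod z)\<^sup>2))) \<in> borel_measurable lborel"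
    by measurable
qed

lemma fock_inner_self: "fock_inner \<alpha> f f = of_real (fock_norm_sq \<alpha> f)"
proof -
  have "(\<lambda>z. f z * cnj (f z) * of_real (exp (- \<alpha> * (cmod z)\<^sup>2)))
     = (\<lambda>z. complex_of_real ((cmod (f z))\<^sup>2 * exp (- \<alpha> * (cmod z)\<^sup>2)))"
    by (simp only: complex_norm_square of_real_mult)
  thus ?thesis
    unfolding fock_inner_def fock_norm_sq_def
    by (simp only: integral_complex_of_real of_real_mult[of "\<alpha> / pi"])
qed

lemma fock_inner_commute: "fock_inner \<alpha> g f = cnj (fock_inner \<alpha> f g)"
proof -
  have "cnj (LINT z|lborel. f z * cnj (g z) * of_real (exp (- \<alpha> * (cmod z)\<^sup>2)))
     = (LINT z|lborel. cnj (f z * cnj (g z) * of_real (exp (- \<alpha> * (cmod z)\<^sup>2))))"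
    by (rule Bochner_Integration.integral_cnj[symmetric])
  thus ?thesis unfolding fock_inner_def by (simp add: mult_ac)
qed

lemma fock_inner_diff_left:
  assumes "f \<in> fock_space \<alpha>" "g \<in> fock_space \<alpha>" "h \<in> fock_space \<alpha>"
  shows "fock_inner \<alpha> (\<lambda>z. f z - g z) h = fock_inner \<alpha> f h - fock_inner \<alpha> g h"
  unfolding fock_inner_def right_diff_distrib[symmetric]
    Bochner_Integration.integral_diff[OF fock_inner_integrable[OF assms(1,3)] fock_inner_integrable[OF assms(2,3)], symmetric]
  by (simp only: left_diff_distrib)

lemma fock_inner_sum_left:
  assumes "\<And>k. k \<in> I \<Longrightarrow> f k \<in> fock_space \<alpha>" "h \<in> fock_space \<alpha>"
  shows "fock_inner \<alpha> (\<lambda>z. \<Sum>k\<in>I. c k * f k z) h = (\<Sum>k\<in>I. c k * fock_inner \<alpha> (f k) h)"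
proof -
  have "(LINT z|lborel. (\<Sum>k\<in>I. c k * f k z) * cnj (h z) * of_real (exp (- \<alpha> * (cmod z)\<^sup>2)))
      = (LINT z|lborel. (\<Sum>k\<in>I. c k * (f k z * cnj (h z) * of_real (exp (- \<alpha> * (cmod z)\<^sup>2)))))"
    by (simp add: sum_distrib_right mult.assoc)
  also have "\<dots> = (\<Sum>k\<in>I. c k * (LINT z|lborel. f k z * cnj (h z) * of_real (exp (- \<alpha> * (cmod z)\<^sup>2))))"
    using fock_inner_integrable[OF assms(1) assms(2)]
    by (subst Bochner_Integration.integral_sum) (auto intro!: sum.cong)
  finally show ?thesis unfolding fock_inner_def by (simp only: sum_distrib_left mult_ac)
qed

lemma fock_inner_diff_right:
  assumes "f \<in> fock_space \<alpha>" "g \<in> fock_space \<alpha>" "h \<in> fock_space \<alpha>"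
  shows "fock_inner \<alpha> h (\<lambda>z. f z - g z) = fock_inner \<alpha> h f - fock_inner \<alpha> h g"
proof -
  have "fock_inner \<alpha> h k = cnj (fock_inner \<alpha> k h)" for k by (rule fock_inner_commute)
  thus ?thesis by (simp only: fock_inner_diff_left[OF assms] complex_cnj_diff)
qed

lemma fock_inner_sum_right:
  assumes "\<And>k. k \<in> I \<Longrightarrow> f k \<in> fock_space \<alpha>" "h \<in> fock_space \<alpha>"
  shows "fock_inner \<alpha> h (\<lambda>z. \<Sum>k\<in>I. c k * f k z) = (\<Sum>k\<in>I. cnj (c k) * fock_inner \<alpha> h (f k))"
proof -
  have "fock_inner \<alpha> h g = cnj (fock_inner \<alpha> g h)" for g by (rule fock_inner_commute)
  moreover have "fock_inner \<alpha> (\<lambda>z. \<Sum>k\<in>I. c k * f k z) h = (\<Sum>k\<in>I. c k * fock_inner \<alpha> (f k) h)"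
    by (rule fock_inner_sum_left[OF assms])
  ultimately show ?thesis by (simp only: cnj_sum complex_cnj_mult)
qed

lemma fock_norm_sq_diff_le:
  assumes "\<alpha> > 0" and f: "f \<in> fock_space \<alpha>" and g: "g \<in> fock_space \<alpha>"
  shows "fock_norm_sq \<alpha> (\<lambda>z. f z - g z) \<le> 2 * fock_norm_sq \<alpha> f + 2 * fock_norm_sq \<alpha> g"
proof -
  have "(LINT z|lborel. (cmod (f z - g z))\<^sup>2 * exp (- \<alpha> * (cmod z)\<^sup>2))
      \<le> (LINT z|lborel. 2 * ((cmod (f z))\<^sup>2 * exp (- \<alpha> * (cmod z)\<^sup>2)) + 2 * ((cmod (g z))\<^sup>2 * exp (- \<alpha> * (cmod z)\<^sup>2)))"
  proof (rule integral_mono)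
    show "integrable lborel (\<lambda>z. (cmod (f z - g z))\<^sup>2 * exp (- \<alpha> * (cmod z)\<^sup>2))"
      by (rule fock_space_integrable[OF fock_space_diff[OF f g]])
    show "integrable lborel (\<lambda>z. 2 * ((cmod (f z))\<^sup>2 * exp (- \<alpha> * (cmod z)\<^sup>2)) + 2 * ((cmod (g z))\<^sup>2 * exp (- \<alpha> * (cmod z)\<^sup>2)))"
      using fock_space_integrable[OF f] fock_space_integrable[OF g] by auto
    show "(cmod (f z - g z))\<^sup>2 * exp (- \<alpha> * (cmod z)\<^sup>2)
       \<le> 2 * ((cmod (f z))\<^sup>2 * exp (- \<alpha> * (cmod z)\<^sup>2)) + 2 * ((cmod (g z))\<^sup>2 * exp (- \<alpha> * (cmod z)\<^sup>2))" for z
      using mult_right_mono[OF norm_add_square_le[of "f z" "- g z"], of "exp (- \<alpha> * (cmod z)\<^sup>2)"]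
      by (simp add: algebra_simps)
  qed
  also have "\<dots> = 2 * (LINT z|lborel. (cmod (f z))\<^sup>2 * exp (- \<alpha> * (cmod z)\<^sup>2))
      + 2 * (LINT z|lborel. (cmod (g z))\<^sup>2 * exp (- \<alpha> * (cmod z)\<^sup>2))"
    using fock_space_integrable[OF f] fock_space_integrable[OF g] by simp
  finally have le: "(LINT z|lborel. (cmod (f z - g z))\<^sup>2 * exp (- \<alpha> * (cmod z)\<^sup>2)) \<le> \<dots>" .
  define c where "c = \<alpha> / pi"
  have "c \<ge> 0" using assms(1) by (simp add: c_def)
  from mult_left_mono[OF le this] show ?thesis
    unfolding fock_norm_sq_def c_def[symmetric] by (simp only: distrib_left mult.left_commute[of c 2])
qed

text \<open>The Cauchy--Schwarz inequality in its weighted arithmetic--geometric form, which is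
  integrated directly from the pointwise inequality.\<close>

lemma fock_inner_le:
  assumes "\<alpha> > 0" "t > 0" and f: "f \<in> fock_space \<alpha>" and g: "g \<in> fock_space \<alpha>"
  shows "2 * cmod (fock_inner \<alpha> f g) \<le> t * fock_norm_sq \<alpha> f + fock_norm_sq \<alpha> g / t"
proof -
  have amgm: "2 * (x * y) \<le> t * x\<^sup>2 + y\<^sup>2 / t" for x y :: real
    using mult_left_mono[OF zero_le_power2[of "t * x - y"], of "1 / t"] \<open>t > 0\<close>
    by (simp add: power2_eq_square field_simps)
  have "2 * cmod (LINT z|lborel. f z * cnj (g z) * of_real (exp (- \<alpha> * (cmod z)\<^sup>2)))
      \<le> 2 * (LINT z|lborel. cmod (f z * cnj (g z) * of_real (exp (- \<alpha> * (cmod z)\<^sup>2))))"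
    using integral_norm_bound by (intro mult_left_mono) auto
  also have "\<dots> = (LINT z|lborel. 2 * cmod (f z * cnj (g z) * of_real (exp (- \<alpha> * (cmod z)\<^sup>2))))"
    by simp
  also have "\<dots> \<le> (LINT z|lborel. t * ((cmod (f z))\<^sup>2 * exp (- \<alpha> * (cmod z)\<^sup>2)) + ((cmod (g z))\<^sup>2 * exp (- \<alpha> * (cmod z)\<^sup>2)) / t)"
  proof (rule integral_mono)
    show "integrable lborel (\<lambda>z. 2 * cmod (f z * cnj (g z) * of_real (exp (- \<alpha> * (cmod z)\<^sup>2))))"
      using fock_inner_integrable[OF f g] by (intro integrable_mult_right integrable_norm)
    show "integrable lborel (\<lambda>z. t * ((cmod (f z))\<^sup>2 * exp (- \<alpha> * (cmod z)\<^sup>2)) + ((cmod (g z))\<^sup>2 * exp (- \<alpha> * (cmod z)\<^sup>2)) / t)"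
      using fock_space_integrable[OF f] fock_space_integrable[OF g] by auto
    show "2 * cmod (f z * cnj (g z) * of_real (exp (- \<alpha> * (cmod z)\<^sup>2)))
       \<le> t * ((cmod (f z))\<^sup>2 * exp (- \<alpha> * (cmod z)\<^sup>2)) + ((cmod (g z))\<^sup>2 * exp (- \<alpha> * (cmod z)\<^sup>2)) / t" for z
      using mult_right_mono[OF amgm[of "cmod (f z)" "cmod (g z)"], of "exp (- \<alpha> * (cmod z)\<^sup>2)"]
      by (simp add: norm_mult algebra_simps)
  qed
  also have "\<dots> = t * (LINT z|lborel. (cmod (f z))\<^sup>2 * exp (- \<alpha> * (cmod z)\<^sup>2))
      + (LINT z|lborel. (cmod (g z))\<^sup>2 * exp (- \<alpha> * (cmod z)\<^sup>2)) / t"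
    using fock_space_integrable[OF f] fock_space_integrable[OF g] by simp
  finally have le: "2 * cmod (LINT z|lborel. f z * cnj (g z) * of_real (exp (- \<alpha> * (cmod z)\<^sup>2))) \<le> \<dots>" .
  define c where "c = \<alpha> / pi"
  have c: "c \<ge> 0" using assms(1) by (simp add: c_def)
  from mult_left_mono[OF le this] show ?thesis
    unfolding fock_norm_sq_def fock_inner_def c_def[symmetric] norm_mult norm_of_real abs_of_nonneg[OF c]
    by (simp only: distrib_left mult.left_commute[of c] times_divide_eq_right)
qed

text \<open>Pythagoras for the projection onto the span of a finite orthonormal family.\<close>

lemma fock_norm_sq_minus_projection:
  fixes m :: nat
  assumes orth: "\<And>j k. j < m \<Longrightarrow> k < m \<Longrightarrow> fock_inner \<alpha> (\<phi> j) (\<phi> k) = (if j = k then 1 else 0)"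
    and \<phi>: "\<And>k. k < m \<Longrightarrow> \<phi> k \<in> fock_space \<alpha>" and f: "f \<in> fock_space \<alpha>"
  shows "fock_norm_sq \<alpha> (\<lambda>z. f z - (\<Sum>k<m. fock_inner \<alpha> f (\<phi> k) * \<phi> k z))
     = fock_norm_sq \<alpha> f - (\<Sum>k<m. (cmod (fock_inner \<alpha> f (\<phi> k)))\<^sup>2)"
proof -
  define c where "c k = fock_inner \<alpha> f (\<phi> k)" for k
  define p where "p z = (\<Sum>k<m. c k * \<phi> k z)" for z
  have p: "p \<in> fock_space \<alpha>" unfolding p_def[abs_def]
    by (intro fock_space_sum fock_space_scale \<phi>) auto
  have fp: "fock_inner \<alpha> g p = (\<Sum>k<m. cnj (c k) * fock_inner \<alpha> g (\<phi> k))" if "g \<in> fock_space \<alpha>" for g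
    unfolding p_def[abs_def] by (rule fock_inner_sum_right) (use \<phi> that in auto)
  have p\<phi>: "fock_inner \<alpha> p (\<phi> k) = c k" if "k < m" for k
  proof -
    have "fock_inner \<alpha> p (\<phi> k) = (\<Sum>j<m. c j * fock_inner \<alpha> (\<phi> j) (\<phi> k))"
      unfolding p_def[abs_def] by (rule fock_inner_sum_left) (use \<phi> that in auto)
    also have "\<dots> = (\<Sum>j<m. if j = k then c j else 0)"
      using orth that by (intro sum.cong) auto
    also have "\<dots> = c k" using that by simp
    finally show ?thesis .
  qed
  define s where "s = (\<Sum>k<m. (cmod (c k))\<^sup>2)"
  have s: "(\<Sum>k<m. cnj (c k) * c k) = of_real s"
    unfolding s_def of_real_sum complex_norm_square by (simp only: mult.commute)
  have "fock_inner \<alpha> f p = of_real s" "fock_inner \<alpha> p p = of_real s"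
    using fp[OF f] fp[OF p] p\<phi> s by (simp_all add: c_def)
  moreover from this(1) have "fock_inner \<alpha> p f = of_real s"
    by (subst fock_inner_commute) simp
  moreover have "fock_inner \<alpha> (\<lambda>z. f z - p z) (\<lambda>z. f z - p z)
      = fock_inner \<alpha> f f - fock_inner \<alpha> f p - (fock_inner \<alpha> p f - fock_inner \<alpha> p p)"
    by (simp only: fock_inner_diff_left fock_inner_diff_right fock_space_diff f p)
  ultimately have "fock_inner \<alpha> (\<lambda>z. f z - p z) (\<lambda>z. f z - p z) = of_real (fock_norm_sq \<alpha> f - s)"
    by (simp add: fock_inner_self[of \<alpha> f])
  thus ?thesis unfolding fock_inner_self of_real_eq_iff by (simp add: p_def s_def c_def)
qed

section \<open>Translations and coherent states\<close>

text \<open>The exponential factor of the translation turns the weight at \<open>l + z\<close> into the weight at \<open>z\<close>;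
  this pointwise identity is why translations are isometric.\<close>

lemma fock_translation_pointwise:
  "fock_translation \<alpha> l f (l + z) * cnj (fock_translation \<alpha> l g (l + z)) * of_real (exp (- \<alpha> * (cmod (l + z))\<^sup>2))
   = f z * cnj (g z) * of_real (exp (- \<alpha> * (cmod z)\<^sup>2))"
proof -
  define e where "e = of_real \<alpha> * cnj l * (l + z) - of_real (\<alpha> / 2 * (cmod l)\<^sup>2)"
  have "exp e * cnj (exp e) * of_real (exp (- \<alpha> * (cmod (l + z))\<^sup>2))
      = exp (e + cnj e + of_real (- \<alpha> * (cmod (l + z))\<^sup>2))"
    unfolding exp_cnj[symmetric] exp_add exp_of_real ..
  also have "e + cnj e + of_real (- \<alpha> * (cmod (l + z))\<^sup>2) = of_real (- \<alpha> * (cmod z)\<^sup>2)"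
    unfolding e_def cmod_power2 by (rule complex_eqI) (simp_all add: power2_eq_square algebra_simps)
  finally have "exp e * cnj (exp e) * of_real (exp (- \<alpha> * (cmod (l + z))\<^sup>2)) = of_real (exp (- \<alpha> * (cmod z)\<^sup>2))"
    by (simp only: exp_of_real)
  thus ?thesis by (simp add: fock_translation_def e_def mult_ac)
qed

lemma fock_translation_measurable:
  assumes [measurable]: "f \<in> borel_measurable borel"
  shows "fock_translation \<alpha> l f \<in> borel_measurable borel"
proof -
  have [measurable]: "(\<lambda>z. exp (of_real \<alpha> * cnj l * z - of_real (\<alpha> / 2 * (cmod l)\<^sup>2))) \<in> borel_measurable borel"
    by (intro borel_measurable_continuous_onI continuous_intros)
  show ?thesis unfolding fock_translation_def[abs_def] by measurable
qed

lemma fock_inner_translation: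
  assumes f[measurable]: "f \<in> borel_measurable borel" and g[measurable]: "g \<in> borel_measurable borel"
  shows "fock_inner \<alpha> (fock_translation \<alpha> l f) (fock_translation \<alpha> l g) = fock_inner \<alpha> f g"
proof -
  note [measurable] = fock_translation_measurable[OF f] fock_translation_measurable[OF g]
  have [measurable]: "cnj \<in> borel_measurable borel"
    by (intro borel_measurable_continuous_onI continuous_intros)
  have "(\<lambda>z. fock_translation \<alpha> l f z * cnj (fock_translation \<alpha> l g z) * of_real (exp (- \<alpha> * (cmod z)\<^sup>2))) \<in> borel_measurable borel"
    by measurable
  from integral_lborel_shift[OF this, of l] show ?thesis
    by (simp only: fock_translation_pointwise fock_inner_def)
qed

lemma fock_translation_in_fock_space:
  assumes f: "f \<in> fock_space \<alpha>"
  shows "fock_translation \<alpha> l f \<in> fock_space \<alpha>"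
proof -
  note [measurable] = fock_translation_measurable[OF fock_space_measurable[OF f]]
  have pw: "(cmod (fock_translation \<alpha> l f (l + z)))\<^sup>2 * exp (- \<alpha> * (cmod (l + z))\<^sup>2)
      = (cmod (f z))\<^sup>2 * exp (- \<alpha> * (cmod z)\<^sup>2)" for z
    using fock_translation_pointwise[of \<alpha> l f z f]
    unfolding complex_norm_square[symmetric] of_real_mult[symmetric] of_real_eq_iff .
  have "(\<lambda>z. (cmod (fock_translation \<alpha> l f z))\<^sup>2 * exp (- \<alpha> * (cmod z)\<^sup>2)) \<in> borel_measurable borel"
    by measurable
  from integrable_lborel_shift[OF this, of l]
  have "integrable lborel (\<lambda>z. (cmod (fock_translation \<alpha> l f z))\<^sup>2 * exp (- \<alpha> * (cmod z)\<^sup>2))"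
    using fock_space_integrable[OF f] by (simp only: pw)
  moreover have "fock_translation \<alpha> l f holomorphic_on UNIV"
  proof -
    have "(f \<circ> (\<lambda>z. z - l)) holomorphic_on UNIV"
      using f by (intro holomorphic_on_compose holomorphic_intros) (auto simp: fock_space_def intro: holomorphic_on_subset)
    thus ?thesis unfolding fock_translation_def[abs_def] comp_def by (intro holomorphic_intros)
  qed
  ultimately show ?thesis by (simp add: fock_space_def)
qed

lemma fock_basis_in_fock_space:
  assumes "\<alpha> > 0"
  shows "fock_basis \<alpha> k \<in> fock_space \<alpha>"
proof -
  have hol: "fock_basis \<alpha> k holomorphic_on UNIV"
    unfolding fock_basis_def[abs_def] by (intro holomorphic_intros)
  define C where "C = cmod (of_real (sqrt (\<alpha> ^ k) / sqrt (fact k))) * fact k"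
  have le: "cmod (fock_basis \<alpha> k z) \<le> C * exp (cmod z)" for z
    using mult_left_mono[OF power_le_exp_norm[of z k], of "cmod (of_real (sqrt (\<alpha> ^ k) / sqrt (fact k)))"]
    by (simp only: fock_basis_def norm_mult C_def mult.assoc norm_ge_zero)
  have "cmod (of_real ((cmod (fock_basis \<alpha> k z))\<^sup>2)) \<le> C\<^sup>2 * exp (2 * cmod z)" for z
    using power_mono[OF le[of z], of 2] by (simp add: power_mult_distrib exp_double norm_power)
  moreover have "(\<lambda>z. complex_of_real ((cmod (fock_basis \<alpha> k z))\<^sup>2)) \<in> borel_measurable borel"
    using hol by (intro borel_measurable_continuous_onI continuous_intros holomorphic_on_imp_continuous_on)
  ultimately have "integrable lborel (\<lambda>z. complex_of_real ((cmod (fock_basis \<alpha> k z))\<^sup>2) * of_real (exp (- \<alpha> * (cmod z)\<^sup>2)))"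
    using assms by (intro integrable_gaussian_exp_growth) auto
  hence "integrable lborel (\<lambda>z. (cmod (fock_basis \<alpha> k z))\<^sup>2 * exp (- \<alpha> * (cmod z)\<^sup>2))"
    unfolding of_real_mult[symmetric] complex_of_real_integrable_eq .
  thus ?thesis using hol by (simp add: fock_space_def)
qed

lemma fock_basis_orthonormal:
  assumes "\<alpha> > 0"
  shows "fock_inner \<alpha> (fock_basis \<alpha> j) (fock_basis \<alpha> k) = (if j = k then 1 else 0)"
proof -
  let ?c = "\<lambda>k. complex_of_real (sqrt (\<alpha> ^ k) / sqrt (fact k))"
  have "(LINT z|lborel. fock_basis \<alpha> j z * cnj (fock_basis \<alpha> k z) * of_real (exp (- \<alpha> * (cmod z)\<^sup>2)))
      = (LINT z|lborel. (?c j * ?c k) * (z ^ j * cnj z ^ k * of_real (exp (- \<alpha> * (cmod z)\<^sup>2))))"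
    by (simp add: fock_basis_def mult_ac)
  also have "\<dots> = (?c j * ?c k) * (if j = k then of_real (pi / \<alpha> * (fact k / \<alpha> ^ k)) else 0)"
    by (simp only: integral_mult_right_zero monomial_gaussian_integral[OF assms])
  also have "\<dots> = (if j = k then of_real (pi / \<alpha>) else 0)"
  proof (cases "j = k")
    case True
    have "(sqrt (\<alpha> ^ k) / sqrt (fact k)) * (sqrt (\<alpha> ^ k) / sqrt (fact k)) * (pi / \<alpha> * (fact k / \<alpha> ^ k)) = pi / \<alpha>"
      using assms by (simp add: field_simps)
    thus ?thesis unfolding True by (simp only: refl if_True of_real_mult[symmetric])
  qed simp
  finally show ?thesis using assms by (simp add: fock_inner_def flip: of_real_mult)
qed

text \<open>The coefficients of a coherent state centred at \<open>z\<close>, in the basis centred at \<open>l\<close>, have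
  squared moduli that form the Poisson distribution with mean \<open>\<alpha> |z - l|\<^sup>2\<close>. After a shift of the
  variable by \<open>l\<close>, the two exponential factors combine with the weight, up to a constant, to the
  weight times the exponential with coefficient \<open>a = \<alpha> cnj (z - l)\<close>.\<close>

lemma coherent_state_inner_translated_basis:
  assumes "\<alpha> > 0"
  shows "(cmod (fock_inner \<alpha> (fock_translation \<alpha> z (fock_basis \<alpha> 0)) (fock_translation \<alpha> l (fock_basis \<alpha> k))))\<^sup>2
    = exp (- (\<alpha> * (cmod (z - l))\<^sup>2)) * (\<alpha> * (cmod (z - l))\<^sup>2) ^ k / fact k"
proof -
  let ?f = "fock_translation \<alpha> z (fock_basis \<alpha> 0)" and ?g = "fock_translation \<alpha> l (fock_basis \<alpha> k)"
  let ?c = "complex_of_real (sqrt (\<alpha> ^ k) / sqrt (fact k))"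
  have F: "fock_basis \<alpha> i \<in> fock_space \<alpha>" for i by (rule fock_basis_in_fock_space[OF assms])
  define b where "b = of_real \<alpha> * cnj z * l - of_real (\<alpha> / 2 * (cmod z)\<^sup>2) - of_real (\<alpha> / 2 * (cmod l)\<^sup>2)"
  define a where "a = of_real \<alpha> * cnj (z - l)"
  have pw: "?f (l + u) * cnj (?g (l + u)) * of_real (exp (- \<alpha> * (cmod (l + u))\<^sup>2))
     = (?c * exp b) * (cnj u ^ k * exp (a * u) * of_real (exp (- \<alpha> * (cmod u)\<^sup>2)))" for u
  proof -
    define p where "p = of_real \<alpha> * cnj z * (l + u) - of_real (\<alpha> / 2 * (cmod z)\<^sup>2)"
    define q where "q = of_real \<alpha> * cnj l * (l + u) - of_real (\<alpha> / 2 * (cmod l)\<^sup>2)"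
    have "p + cnj q + of_real (- \<alpha> * (cmod (l + u))\<^sup>2) = b + a * u + of_real (- \<alpha> * (cmod u)\<^sup>2)"
      unfolding p_def q_def a_def b_def cmod_power2
      by (rule complex_eqI) (simp_all add: power2_eq_square algebra_simps)
    hence "exp p * cnj (exp q) * of_real (exp (- \<alpha> * (cmod (l + u))\<^sup>2)) = exp b * exp (a * u) * of_real (exp (- \<alpha> * (cmod u)\<^sup>2))"
      unfolding exp_cnj exp_of_real[symmetric] exp_add[symmetric] by (rule arg_cong)
    thus ?thesis by (simp add: fock_translation_def p_def q_def fock_basis_def mult_ac)
  qed
  have meas: "(\<lambda>u. ?f u * cnj (?g u) * of_real (exp (- \<alpha> * (cmod u)\<^sup>2))) \<in> borel_measurable borel"
    using borel_measurable_integrable[OF fock_inner_integrable[OF fock_translation_in_fock_space[OF F] fock_translation_in_fock_space[OF F]]]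
    by simp
  have "fock_inner \<alpha> ?f ?g = of_real (\<alpha> / pi) * ((?c * exp b) * (of_real (pi / \<alpha>) * (a / of_real \<alpha>) ^ k))"
    unfolding fock_inner_def integral_lborel_shift[OF meas, of l, symmetric] pw
    by (simp only: integral_mult_right_zero exp_monomial_gaussian_integral[OF assms])
  also have "\<dots> = ?c * exp b * cnj (z - l) ^ k"
    using assms by (simp add: a_def)
  finally have "(cmod (fock_inner \<alpha> ?f ?g))\<^sup>2 = (cmod ?c)\<^sup>2 * (cmod (exp b))\<^sup>2 * (cmod (z - l) ^ k)\<^sup>2"
    by (simp only: norm_mult norm_power power_mult_distrib complex_mod_cnj)
  also have "(cmod ?c)\<^sup>2 = \<alpha> ^ k / fact k"
    unfolding norm_of_real using assms by (simp add: power_divide)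
  also have "(cmod (exp b))\<^sup>2 = exp (2 * Re b)"
    by (simp add: exp_double)
  also have "2 * Re b = - (\<alpha> * (cmod (z - l))\<^sup>2)"
    unfolding b_def cmod_power2 by (simp add: power2_eq_square algebra_simps)
  also have "(cmod (z - l) ^ k)\<^sup>2 = ((cmod (z - l))\<^sup>2) ^ k"
    by (simp add: power_mult[symmetric] mult.commute)
  finally show ?thesis by (simp add: power_mult_distrib)
qed

abbreviation coherent_state :: "real \<Rightarrow> complex \<Rightarrow> complex \<Rightarrow> complex" where
  "coherent_state \<alpha> z \<equiv> fock_translation \<alpha> z (fock_basis \<alpha> 0)"

section \<open>Initial segments of the Poisson distribution\<close>

text \<open>Moving the Poisson mean away from \<open>k\<close>, from \<open>y\<close> to \<open>x\<close>, costs a factor that is Gaussian in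
  \<open>\<surd>x - \<surd>y\<close>, as long as both means lie on the same side of \<open>k\<close>. In both cases
  \<open>k ln (x / y) \<le> y ln (x / y)\<close>, and then \<open>ln s \<le> s - 1\<close> is applied to \<open>s = \<surd>(x / y)\<close>. For means
  \<open>\<alpha> |z - l|\<^sup>2\<close> the square roots are proportional to distances,
  which is why the estimate is Gaussian in the distance.\<close>

lemma poisson_weight_compare:
  fixes x y :: real and k :: nat
  assumes x: "x \<ge> 0" and y: "y > 0" and k: "real k \<le> y \<and> y \<le> x \<or> x \<le> y \<and> y \<le> real k"
  shows "exp (- x) * x ^ k \<le> exp (- (sqrt x - sqrt y)\<^sup>2) * (exp (- y) * y ^ k)"
proof (cases "x = 0")
  case True
  with y k have "k > 0" by (intro gr0I) auto
  thus ?thesis using True y by (simp add: power_0_left)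
next
  case False
  hence x: "x > 0" using x by simp
  define a b where "a = sqrt x" and "b = sqrt y"
  have ab: "a > 0" "b > 0" "x = a\<^sup>2" "y = b\<^sup>2" using x y by (auto simp: a_def b_def)
  have ln_eq: "ln (x / y) = 2 * ln (a / b)"
    using ab by (simp add: power_divide[symmetric] ln_realpow)
  have "real k * ln (x / y) \<le> y * ln (x / y)"
  proof (cases "y \<le> x")
    case True
    thus ?thesis using k x y by (cases "x = y") (auto intro!: mult_right_mono)
  next
    case False
    hence "ln (x / y) \<le> 0" using x y by simp
    thus ?thesis using False k by (intro mult_right_mono_neg) auto
  qed
  also have "y * ln (x / y) \<le> y * (2 * (a / b - 1))"
    unfolding ln_eq using ab y by (intro mult_left_mono ln_le_minus_one) auto
  also have "\<dots> = x - y - (a - b)\<^sup>2"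
    using ab by (simp add: field_simps power2_eq_square)
  finally have "exp (real k * ln (x / y)) \<le> exp (x - y - (a - b)\<^sup>2)"
    by (rule exp_le_cancel_iff[THEN iffD2])
  moreover have "exp (real k * ln (x / y)) = x ^ k / y ^ k"
    using x y by (simp add: exp_of_nat_mult power_divide)
  ultimately have "x ^ k / y ^ k \<le> exp x * exp (- y) * exp (- (a - b)\<^sup>2)"
    by (simp add: exp_add[symmetric])
  thus ?thesis using y by (simp add: field_simps exp_minus a_def b_def)
qed

definition poisson_head :: "nat \<Rightarrow> real \<Rightarrow> real" where
  "poisson_head m x = (\<Sum>k<m. exp (- x) * x ^ k / fact k)"

lemma poisson_head_far:
  assumes x: "x \<ge> 0" and y: "real m \<le> y" "y \<le> x" "y > 0"
  shows "poisson_head m x \<le> exp (- (sqrt x - sqrt y)\<^sup>2) * poisson_head m y"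
  unfolding poisson_head_def sum_distrib_left
proof (rule sum_mono)
  fix k assume "k \<in> {..<m}"
  hence "exp (- x) * x ^ k \<le> exp (- (sqrt x - sqrt y)\<^sup>2) * (exp (- y) * y ^ k)"
    using x y by (intro poisson_weight_compare) auto
  from divide_right_mono[OF this, of "fact k"]
  show "exp (- x) * x ^ k / fact k \<le> exp (- (sqrt x - sqrt y)\<^sup>2) * (exp (- y) * y ^ k / fact k)"
    by simp
qed

lemma poisson_sums: "(\<lambda>k. exp (- x) * x ^ k / fact k) sums (1 :: real)"
  using sums_mult[OF exp_converges[of x], of "exp (- x)"] by (simp add: exp_minus divide_inverse mult_ac)

text \<open>The complementary tail is compared with the tail of the Poisson distribution with mean \<open>m\<close>.\<close>

lemma poisson_head_near:
  assumes x: "x \<ge> 0" "x \<le> real m" and m: "m > 0"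
  shows "poisson_head m x \<ge> 1 - exp (- (sqrt (real m) - sqrt x)\<^sup>2)"
proof -
  define E where "E = exp (- (sqrt x - sqrt (real m))\<^sup>2)"
  define p where "p x k = exp (- x) * x ^ k / fact k" for x :: real and k :: nat
  have p: "p x sums 1" for x unfolding p_def by (rule poisson_sums)
  have nonneg: "p x k \<ge> 0" if "x \<ge> 0" for x k using that by (simp add: p_def)
  have summ: "summable (\<lambda>k. p x (k + m))" for x
    using p[of x] by (simp add: sums_iff summable_iff_shift)
  have "p x (k + m) \<le> E * p (real m) (k + m)" for k
  proof -
    have "exp (- x) * x ^ (k + m) \<le> E * (exp (- real m) * real m ^ (k + m))"
      unfolding E_def using x m by (intro poisson_weight_compare) auto
    from divide_right_mono[OF this, of "fact (k + m)"] show ?thesis by (simp add: p_def)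
  qed
  hence "(\<Sum>k. p x (k + m)) \<le> (\<Sum>k. E * p (real m) (k + m))"
    by (intro suminf_le summ summable_mult) auto
  also have "\<dots> = E * (\<Sum>k. p (real m) (k + m))" using summ by (rule suminf_mult)
  also have "\<dots> \<le> E * 1"
  proof (rule mult_left_mono)
    have "1 = (\<Sum>k. p (real m) (k + m)) + (\<Sum>k<m. p (real m) k)"
      using suminf_split_initial_segment[of "p (real m)" m] p[of "real m"] by (simp add: sums_iff)
    moreover have "(\<Sum>k<m. p (real m) k) \<ge> 0" by (intro sum_nonneg nonneg) auto
    ultimately show "(\<Sum>k. p (real m) (k + m)) \<le> 1" by linarith
  qed (simp add: E_def)
  finally have "(\<Sum>k. p x (k + m)) \<le> E" by simp
  moreover have "1 = (\<Sum>k. p x (k + m)) + (\<Sum>k<m. p x k)"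
    using suminf_split_initial_segment[of "p x" m] p[of x] by (simp add: sums_iff)
  ultimately show ?thesis
    by (simp add: poisson_head_def p_def E_def power2_commute)
qed

section \<open>Coherent states and the discs of a divisor\<close>

lemma coherent_state_local_energy:
  assumes "\<alpha> > 0"
  shows "(\<Sum>k<m. (cmod (fock_inner \<alpha> (coherent_state \<alpha> z) (fock_translation \<alpha> l (fock_basis \<alpha> k))))\<^sup>2)
    = poisson_head m (\<alpha> * (cmod (z - l))\<^sup>2)"
  by (simp add: poisson_head_def coherent_state_inner_translated_basis[OF assms])

lemma translated_basis_in_fock_space:
  assumes "\<alpha> > 0"
  shows "fock_translation \<alpha> l (fock_basis \<alpha> k) \<in> fock_space \<alpha>"
  by (intro fock_translation_in_fock_space fock_basis_in_fock_space assms)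

lemma translated_basis_orthonormal:
  assumes "\<alpha> > 0"
  shows "fock_inner \<alpha> (fock_translation \<alpha> l (fock_basis \<alpha> j)) (fock_translation \<alpha> l (fock_basis \<alpha> k)) = (if j = k then 1 else 0)"
  using fock_inner_translation[of "fock_basis \<alpha> j" "fock_basis \<alpha> k" \<alpha> l] fock_basis_orthonormal[OF assms, of j k]
    fock_space_measurable[OF fock_basis_in_fock_space[OF assms]] by simp

lemma coherent_state_norm:
  assumes "\<alpha> > 0"
  shows "fock_norm_sq \<alpha> (coherent_state \<alpha> z) = 1"
  using translated_basis_orthonormal[OF assms, of z 0 0] unfolding fock_inner_self by simp

lemma exp_neg_square_small:
  fixes c \<epsilon> :: real
  assumes "c > 0" "\<epsilon> > 0"
  obtains h where "h > 0" "exp (- c * h\<^sup>2) < \<epsilon>"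
proof
  define y where "y = ln (1 + 1 / \<epsilon>)"
  have y: "y > 0" unfolding y_def using assms by (intro ln_gt_zero) simp
  show "sqrt (y / c) > 0" using y assms by simp
  have "exp (- c * (sqrt (y / c))\<^sup>2) = exp (- y)" using y assms by simp
  also have "\<dots> = 1 / (1 + 1 / \<epsilon>)" 
    using assms by (simp add: y_def exp_minus inverse_eq_divide add_pos_pos)
  also have "\<dots> < \<epsilon>" using assms by (simp add: field_simps)
  finally show "exp (- c * (sqrt (y / c))\<^sup>2) < \<epsilon>" .
qed

text \<open>From far away, one of the four steps of length \<open>h\<close> along the coordinate axes decreases the distance
  to \<open>w\<close> by at least \<open>h / 2\<close>, since some axis direction makes an angle of at most \<open>\<pi> / 4\<close> with \<open>w\<close>.\<close>

lemma step_towards: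
  fixes w :: complex
  assumes "h > 0" "cmod w \<ge> 2 * h"
  shows "\<exists>d\<in>{1, -1, \<i>, -\<i>}. cmod (w - of_real h * d) \<le> cmod w - h / 2"
proof -
  define p where "p = max \<bar>Re w\<bar> \<bar>Im w\<bar>"
  have "\<exists>d\<in>{1, -1, \<i>, -\<i>}. (cmod (w - of_real h * d))\<^sup>2 = (cmod w)\<^sup>2 - 2 * h * p + h\<^sup>2"
    unfolding p_def max_def abs_if cmod_power2
    by (auto simp: power2_eq_square algebra_simps)
  then obtain d where d: "d \<in> {1, -1, \<i>, -\<i>}" "(cmod (w - of_real h * d))\<^sup>2 = (cmod w)\<^sup>2 - 2 * h * p + h\<^sup>2"
    by blast
  \<comment> \<open>\<open>11 / 16\<close> lies below \<open>1 / \<surd>2\<close>, and \<open>(11 / 16) |w| \<ge> |w| / 2 + 3 / 8 h\<close> once \<open>|w| \<ge> 2 h\<close>\<close>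
  have "(11 / 16 * cmod w)\<^sup>2 \<le> (cmod w)\<^sup>2 / 2" by (simp add: power2_eq_square)
  also have "\<dots> \<le> p\<^sup>2"
  proof -
    have "(Re w)\<^sup>2 \<le> p\<^sup>2" "(Im w)\<^sup>2 \<le> p\<^sup>2"
      by (auto simp: p_def intro!: abs_le_square_iff[THEN iffD1])
    thus ?thesis unfolding cmod_power2 by simp
  qed
  finally have "11 / 16 * cmod w \<le> p" by (rule power2_le_imp_le) (simp add: p_def)
  hence "h * (cmod w / 2 + 3 / 8 * h) \<le> h * p" using assms by (intro mult_left_mono) auto
  hence "(cmod (w - of_real h * d))\<^sup>2 \<le> (cmod w - h / 2)\<^sup>2"
    unfolding d(2) by (simp add: power2_eq_square algebra_simps)
  from power2_le_imp_le[OF this] assms have "cmod (w - of_real h * d) \<le> cmod w - h / 2"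
    by simp
  thus ?thesis using d(1) by blast
qed

text \<open>Test the sampling inequalities on coherent states. Let \<open>u z l\<close> be the contribution of the
  node \<open>l\<close> for the coherent state at \<open>z\<close>, so that its sum over \<open>l\<close> lies between \<open>A\<close> and \<open>B\<close> for every
  \<open>z\<close>. If \<open>z\<close> lay far outside all the discs, then a step of length \<open>h\<close> in one of four directions would lead towards
  \<open>l\<close> while staying outside its disc, and the contribution would grow by the factor
  \<open>exp (\<alpha> h\<^sup>2 / 4)\<close> at least. Summing over \<open>l\<close>, the total at \<open>z\<close> would be at most
  \<open>4 B exp (- \<alpha> h\<^sup>2 / 4)\<close>, which is less than \<open>A\<close> for large \<open>h\<close>. Thus the uniform upper
  bound replaces any counting of the nodes.\<close>

lemma sampling_imp_cover:
  assumes \<alpha>: "\<alpha> > 0" and div: "divisor \<Lambda> m" and samp: "sampling \<alpha> \<Lambda> m"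
  obtains C where "C > 0" "\<And>z. \<exists>l\<in>\<Lambda>. cmod (z - l) < sqrt (real (m l) / \<alpha>) + C"
proof -
  define u where "u z l = poisson_head (m l) (\<alpha> * (cmod (z - l))\<^sup>2)" for z l
  obtain A B where AB: "A > 0" "B > 0" and frame: "\<And>z. u z summable_on \<Lambda>" "\<And>z. A \<le> infsum (u z) \<Lambda>" "\<And>z. infsum (u z) \<Lambda> \<le> B"
  proof -
    from samp obtain A B where AB: "A > 0" "B > 0" and *: "\<And>f. f \<in> fock_space \<alpha> \<Longrightarrow>
        (let S = (\<lambda>l. \<Sum>k<m l. (cmod (fock_inner \<alpha> f (fock_translation \<alpha> l (fock_basis \<alpha> k))))\<^sup>2)
         in S summable_on \<Lambda> \<and> A * fock_norm_sq \<alpha> f \<le> infsum S \<Lambda> \<and> infsum S \<Lambda> \<le> B * fock_norm_sq \<alpha> f)"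
      unfolding sampling_def by blast
    from *[OF translated_basis_in_fock_space[OF \<alpha>, of _ 0]]
    show ?thesis unfolding coherent_state_local_energy[OF \<alpha>] coherent_state_norm[OF \<alpha>] Let_def
      by (intro that[OF AB]) (auto simp: u_def[abs_def])
  qed
  obtain h where h: "h > 0" "exp (- (\<alpha> / 4) * h\<^sup>2) < A / (4 * B)"
    using exp_neg_square_small[of "\<alpha> / 4" "A / (4 * B)"] \<alpha> AB by auto
  define \<eta> where "\<eta> = exp (- (\<alpha> / 4) * h\<^sup>2)"
  have u_nonneg: "u z l \<ge> 0" for z l
    using \<alpha> by (auto simp: u_def poisson_head_def intro!: sum_nonneg)
  show ?thesis
  proof (rule that[of "2 * h"])
    fix z
    show "\<exists>l\<in>\<Lambda>. cmod (z - l) < sqrt (real (m l) / \<alpha>) + 2 * h"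
    proof (rule ccontr)
      assume "\<not> ?thesis"
      hence far: "cmod (z - l) \<ge> sqrt (real (m l) / \<alpha>) + 2 * h" if "l \<in> \<Lambda>" for l
        using that by force
      define v where "v d = u (z + of_real h * d)" for d
      have le: "u z l \<le> \<eta> * (v 1 l + v (-1) l + (v \<i> l + v (-\<i>) l))" if l: "l \<in> \<Lambda>" for l
      proof -
        have "sqrt (real (m l) / \<alpha>) \<ge> 0" using \<alpha> by simp
        hence "cmod (l - z) \<ge> 2 * h" using far[OF l] unfolding norm_minus_commute[of l z] by linarith
        from step_towards[OF h(1) this] obtain d where d: "d \<in> {1, -1, \<i>, -\<i>}"
          and close: "cmod (l - z - of_real h * d) \<le> cmod (l - z) - h / 2" by blast
        define a b where "a = cmod (z - l)" and "b = cmod (z + of_real h * d - l)"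
        have b_le: "b \<le> a - h / 2"
          using close norm_minus_commute[of l z] norm_minus_commute[of l "z + of_real h * d"]
          by (simp add: a_def b_def algebra_simps)
        have "a \<le> b + cmod (of_real h * d)"
          using norm_triangle_ineq4[of "z + of_real h * d - l" "of_real h * d"] by (simp add: a_def b_def)
        also have "cmod (of_real h * d) = h" using d h by (auto simp: norm_mult)
        finally have r_le: "sqrt (real (m l) / \<alpha>) \<le> b" using far[OF l] h(1) by (simp add: a_def)
        have "m l > 0" using div l by (simp add: divisor_def)
        hence "sqrt (real (m l) / \<alpha>) > 0" using \<alpha> by simp
        hence b: "b > 0" using r_le by linarith
        have "real (m l) / \<alpha> \<le> b\<^sup>2" using r_le by (rule sqrt_le_D)
        hence ml: "real (m l) \<le> \<alpha> * b\<^sup>2" using \<alpha> by (simp add: field_simps)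
        have "u z l \<le> exp (- (sqrt (\<alpha> * a\<^sup>2) - sqrt (\<alpha> * b\<^sup>2))\<^sup>2) * u (z + of_real h * d) l"
          unfolding u_def a_def[symmetric] b_def[symmetric]
          using b_le h(1) b ml \<alpha> by (intro poisson_head_far) (auto intro!: mult_left_mono power_mono)
        also have "\<dots> \<le> \<eta> * v d l"
        proof -
          have "sqrt (\<alpha> * a\<^sup>2) - sqrt (\<alpha> * b\<^sup>2) = sqrt \<alpha> * (a - b)"
            using b b_le h(1) by (simp add: real_sqrt_mult algebra_simps)
          hence "(sqrt (\<alpha> * a\<^sup>2) - sqrt (\<alpha> * b\<^sup>2))\<^sup>2 = \<alpha> * (a - b)\<^sup>2"
            using \<alpha> by (simp add: power_mult_distrib)
          moreover have "(h / 2)\<^sup>2 \<le> (a - b)\<^sup>2" using b_le h(1) by (intro power_mono) auto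
          ultimately have "\<alpha> / 4 * h\<^sup>2 \<le> (sqrt (\<alpha> * a\<^sup>2) - sqrt (\<alpha> * b\<^sup>2))\<^sup>2"
            using mult_left_mono[of "(h / 2)\<^sup>2" "(a - b)\<^sup>2" \<alpha>] \<alpha> by (simp add: power_divide)
          thus ?thesis unfolding v_def \<eta>_def using u_nonneg by (intro mult_right_mono) auto
        qed
        also have "v d l \<le> v 1 l + v (-1) l + (v \<i> l + v (-\<i>) l)"
          using d u_nonneg by (auto simp: v_def add_nonneg_nonneg)
        finally show ?thesis by (simp add: \<eta>_def)
      qed
      have v: "v d summable_on \<Lambda>" "infsum (v d) \<Lambda> \<le> B" for d
        unfolding v_def using frame by auto
      have "A \<le> infsum (u z) \<Lambda>" by (rule frame)
      also have "\<dots> \<le> infsum (\<lambda>l. \<eta> * (v 1 l + v (-1) l + (v \<i> l + v (-\<i>) l))) \<Lambda>"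
        by (intro infsum_mono summable_on_cmult_right summable_on_add frame v le)
      also have "\<dots> = \<eta> * (infsum (v 1) \<Lambda> + infsum (v (-1)) \<Lambda> + (infsum (v \<i>) \<Lambda> + infsum (v (-\<i>)) \<Lambda>))"
        by (simp add: infsum_cmult_right' infsum_add summable_on_add v)
      also have "\<dots> \<le> \<eta> * (B + B + (B + B))"
        by (intro mult_left_mono add_mono v) (simp add: \<eta>_def)
      also have "\<dots> < A" using h(2) AB by (simp add: \<eta>_def field_simps)
      finally show False by simp
    qed
  qed (use h in auto)
qed

text \<open>If \<open>z\<close> lay deep inside two discs, then the coherent state at \<open>z\<close> would almost coincide with
  its projection \<open>P l\<close> onto the span of the basis functions centred at \<open>l\<close>, and likewise with \<open>P l'\<close>. Interpolation provides a
  function \<open>f\<close> that has the same coefficients as the coherent state at \<open>l\<close> and vanishing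
  coefficients at all other nodes, and the lower sampling inequality
  bounds its norm by its data. Its inner products with \<open>P l\<close> and \<open>P l'\<close> are about \<open>1\<close> and \<open>0\<close>
  although \<open>P l - P l'\<close> is small.\<close>

lemma complete_interpolating_imp_disjoint:
  assumes \<alpha>: "\<alpha> > 0" and div: "divisor \<Lambda> m" and samp: "sampling \<alpha> \<Lambda> m" and inter: "interpolating \<alpha> \<Lambda> m"
  obtains C where "C > 0" "\<And>l l' z. l \<in> \<Lambda> \<Longrightarrow> l' \<in> \<Lambda> \<Longrightarrow> l \<noteq> l' \<Longrightarrow>
    cmod (z - l) \<le> sqrt (real (m l) / \<alpha>) - C \<Longrightarrow> cmod (z - l') \<le> sqrt (real (m l') / \<alpha>) - C \<Longrightarrow> False"
proof -
  let ?E = "\<lambda>l k. fock_translation \<alpha> l (fock_basis \<alpha> k)"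
  note E = translated_basis_in_fock_space[OF \<alpha>]
  from samp obtain A where A: "A > 0" and lower: "\<And>f. f \<in> fock_space \<alpha> \<Longrightarrow>
      A * fock_norm_sq \<alpha> f \<le> infsum (\<lambda>l. \<Sum>k<m l. (cmod (fock_inner \<alpha> f (?E l k)))\<^sup>2) \<Lambda>"
    unfolding sampling_def Let_def by blast
  obtain C where C: "C > 0" "exp (- \<alpha> * C\<^sup>2) < A / (A + 4)"
    using exp_neg_square_small[of \<alpha> "A / (A + 4)"] \<alpha> A by auto
  define \<epsilon> where "\<epsilon> = exp (- \<alpha> * C\<^sup>2)"
  show ?thesis
  proof (rule that[OF C(1)])
    fix l l' z
    assume l: "l \<in> \<Lambda>" "l' \<in> \<Lambda>" "l \<noteq> l'"
      and z: "cmod (z - l) \<le> sqrt (real (m l) / \<alpha>) - C" "cmod (z - l') \<le> sqrt (real (m l') / \<alpha>) - C"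
    let ?\<kappa> = "coherent_state \<alpha> z"
    define P where "P x w = (\<Sum>k<m x. fock_inner \<alpha> ?\<kappa> (?E x k) * ?E x k w)" for x w
    define s where "s x = (\<Sum>k<m x. (cmod (fock_inner \<alpha> ?\<kappa> (?E x k)))\<^sup>2)" for x
    have P: "P x \<in> fock_space \<alpha>" for x
      unfolding P_def[abs_def] by (intro fock_space_sum fock_space_scale E)
    have dist: "fock_norm_sq \<alpha> (\<lambda>w. ?\<kappa> w - P x w) = 1 - s x" for x
      unfolding P_def s_def coherent_state_norm[OF \<alpha>, of z, symmetric]
      by (rule fock_norm_sq_minus_projection) (use translated_basis_orthonormal[OF \<alpha>] E in auto)
    have close: "s x \<ge> 1 - \<epsilon>" if x: "x \<in> \<Lambda>" "cmod (z - x) \<le> sqrt (real (m x) / \<alpha>) - C" for x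
    proof -
      have "sqrt \<alpha> * (cmod (z - x) + C) \<le> sqrt \<alpha> * sqrt (real (m x) / \<alpha>)"
        using x(2) \<alpha> by (intro mult_left_mono) auto
      hence gap: "sqrt (\<alpha> * (cmod (z - x))\<^sup>2) + sqrt \<alpha> * C \<le> sqrt (real (m x))"
        using \<alpha> by (simp add: real_sqrt_mult real_sqrt_divide algebra_simps)
      hence "sqrt (\<alpha> * (cmod (z - x))\<^sup>2) \<le> sqrt (real (m x))"
        using C(1) \<alpha> by (smt (verit) mult_nonneg_nonneg real_sqrt_ge_zero)
      hence le: "\<alpha> * (cmod (z - x))\<^sup>2 \<le> real (m x)" by simp
      have "(sqrt \<alpha> * C)\<^sup>2 \<le> (sqrt (real (m x)) - sqrt (\<alpha> * (cmod (z - x))\<^sup>2))\<^sup>2"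
        using gap C(1) \<alpha> by (intro power_mono) auto
      hence "exp (- (sqrt (real (m x)) - sqrt (\<alpha> * (cmod (z - x))\<^sup>2))\<^sup>2) \<le> \<epsilon>"
        using \<alpha> by (simp add: \<epsilon>_def power_mult_distrib)
      moreover have "s x \<ge> 1 - exp (- (sqrt (real (m x)) - sqrt (\<alpha> * (cmod (z - x))\<^sup>2))\<^sup>2)"
        unfolding s_def coherent_state_local_energy[OF \<alpha>]
        using le \<alpha> div x(1) by (intro poisson_head_near) (auto simp: divisor_def)
      ultimately show ?thesis by linarith
    qed
    define v where "v x k = (if x = l then fock_inner \<alpha> ?\<kappa> (?E l k) else 0)" for x k
    have v_sum: "(\<Sum>k<m x. (cmod (v x k))\<^sup>2) = (if x = l then s l else 0)" for x
      by (simp add: v_def s_def)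
    have v_has: "((\<lambda>x. \<Sum>k<m x. (cmod (v x k))\<^sup>2) has_sum s l) \<Lambda>"
      unfolding v_sum using l(1)
      by (intro has_sum_finite_neutralI[of "{l}"]) auto
    obtain f where f: "f \<in> fock_space \<alpha>" and fv: "\<And>x k. x \<in> \<Lambda> \<Longrightarrow> k < m x \<Longrightarrow> fock_inner \<alpha> f (?E x k) = v x k"
      using inter v_has unfolding interpolating_def summable_on_def by blast
    have "infsum (\<lambda>x. \<Sum>k<m x. (cmod (fock_inner \<alpha> f (?E x k)))\<^sup>2) \<Lambda> = infsum (\<lambda>x. \<Sum>k<m x. (cmod (v x k))\<^sup>2) \<Lambda>"
      by (intro infsum_cong sum.cong) (simp_all add: fv)
    also have "\<dots> = s l" using v_has by (rule infsumI)
    finally have f_norm: "A * fock_norm_sq \<alpha> f \<le> s l" using lower[OF f] by simp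
    have fP: "fock_inner \<alpha> f (P x) = (\<Sum>k<m x. cnj (fock_inner \<alpha> ?\<kappa> (?E x k)) * v x k)" if "x \<in> \<Lambda>" for x
      unfolding P_def[abs_def] by (subst fock_inner_sum_right) (use E f fv that in auto)
    have "fock_inner \<alpha> f (P l') = 0" using fP[OF l(2)] l(3) by (simp add: v_def)
    moreover have "fock_inner \<alpha> f (P l) = of_real (s l)"
      unfolding fP[OF l(1)] s_def of_real_sum complex_norm_square by (simp add: v_def mult.commute)
    ultimately have fq: "fock_inner \<alpha> f (\<lambda>w. P l w - P l' w) = of_real (s l)"
      by (simp add: fock_inner_diff_right f P)
    let ?q = "\<lambda>w. P l w - P l' w"
    have q_norm: "fock_norm_sq \<alpha> ?q \<le> 4 * \<epsilon>"
    proof -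
      have D: "(\<lambda>w. ?\<kappa> w - P x w) \<in> fock_space \<alpha>" for x by (intro fock_space_diff E P)
      have "fock_norm_sq \<alpha> ?q = fock_norm_sq \<alpha> (\<lambda>w. (?\<kappa> w - P l' w) - (?\<kappa> w - P l w))" by simp
      also have "\<dots> \<le> 2 * fock_norm_sq \<alpha> (\<lambda>w. ?\<kappa> w - P l' w) + 2 * fock_norm_sq \<alpha> (\<lambda>w. ?\<kappa> w - P l w)"
        by (rule fock_norm_sq_diff_le[OF \<alpha> D D])
      also have "\<dots> = 2 * (1 - s l') + 2 * (1 - s l)" by (simp only: dist)
      finally show ?thesis using close[OF l(1) z(1)] close[OF l(2) z(2)] by simp
    qed
    have "2 * s l \<le> 2 * cmod (fock_inner \<alpha> f ?q)"
      unfolding fq by simp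
    also have "\<dots> \<le> A * fock_norm_sq \<alpha> f + fock_norm_sq \<alpha> ?q / A"
      by (rule fock_inner_le[OF \<alpha> A f fock_space_diff[OF P P]])
    also have "\<dots> \<le> s l + 4 * \<epsilon> / A"
      using f_norm q_norm A by (intro add_mono divide_right_mono) auto
    finally have "s l \<le> 4 * \<epsilon> / A" by simp
    hence "1 - \<epsilon> \<le> 4 * \<epsilon> / A" using close[OF l(1) z(1)] by linarith
    hence "A \<le> \<epsilon> * (A + 4)" using A by (simp add: field_simps)
    moreover have "\<epsilon> * (A + 4) < A" using C(2) A by (simp add: \<epsilon>_def field_simps)
    ultimately show False by simp
  qed
qed

section \<open>Gaps between large disjoint discs\<close>

text \<open>Seen from \<open>w\<close>, the centres of two disjoint large discs that pass close to \<open>w\<close> lie in almost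
  opposite directions. Three directions cannot be pairwise almost opposite: three unit vectors
  with pairwise inner products below \<open>-1/2\<close> would have a sum of negative squared length.\<close>

lemma three_almost_touching_discs:
  fixes w :: complex and l :: "nat \<Rightarrow> complex" and r :: "nat \<Rightarrow> real"
  assumes t: "t > 0" and r: "\<And>i. i < 3 \<Longrightarrow> r i \<ge> 10 * t"
    and near: "\<And>i. i < 3 \<Longrightarrow> cmod (w - l i) \<le> r i + t"
    and disj: "\<And>i j. i < 3 \<Longrightarrow> j < 3 \<Longrightarrow> i \<noteq> j \<Longrightarrow> cmod (l i - l j) \<ge> r i + r j"
  shows False
proof -
  define u where "u i = l i - w" for i
  define d where "d i = cmod (u i)" for i
  have tri: "cmod (l i - l j) \<le> d i + d j" for i j
    using norm_triangle_ineq4[of "u i" "u j"] by (simp add: u_def d_def)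
  have d_le: "d i \<le> r i + t" if "i < 3" for i
    using near[OF that] by (simp add: d_def u_def norm_minus_commute)
  have d_ge: "d i \<ge> 9 * t" if "i < 3" for i
  proof -
    define j where "j = (if i = 0 then 1 else 0 :: nat)"
    have "j < 3" "i \<noteq> j" by (auto simp: j_def)
    with that r[of i] tri[of i j] disj[of i j] d_le[of j] show ?thesis by simp
  qed
  have pair: "inner (u i) (u j) < - (d i * d j) / 2" if ij: "i < 3" "j < 3" "i \<noteq> j" for i j
  proof -
    have "d i + d j - 2 * t \<le> cmod (l i - l j)"
      using disj[OF ij] d_le[OF ij(1)] d_le[OF ij(2)] by simp
    also have "cmod (l i - l j) = norm (u i - u j)" by (simp add: u_def)
    finally have "(d i + d j - 2 * t)\<^sup>2 \<le> (norm (u i - u j))\<^sup>2"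
      using d_ge[OF ij(1)] d_ge[OF ij(2)] t by (intro power_mono) auto
    also have "\<dots> = (d i)\<^sup>2 + (d j)\<^sup>2 - 2 * inner (u i) (u j)"
      by (simp add: d_def power2_norm_eq_inner inner_diff algebra_simps inner_commute)
    finally have "inner (u i) (u j) \<le> - (d i * d j) + 2 * t * d i + 2 * t * d j - 2 * t\<^sup>2"
      by (simp add: power2_eq_square algebra_simps)
    moreover have "9 * (t * d i) \<le> d i * d j" "9 * (t * d j) \<le> d i * d j"
      using mult_right_mono[OF d_ge[OF ij(2)], of "d i"] mult_right_mono[OF d_ge[OF ij(1)], of "d j"]
      by (auto simp: d_def mult_ac)
    moreover have "d i * d j > 0" using d_ge[OF ij(1)] d_ge[OF ij(2)] t by simp
    moreover have "t\<^sup>2 \<ge> 0" by simp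
    ultimately show ?thesis unfolding mult.assoc by linarith
  qed
  define v where "v i = u i /\<^sub>R d i" for i
  have dpos: "d i > 0" if "i < 3" for i using d_ge[OF that] t by simp
  have vv: "inner (v i) (v i) = 1" if "i < 3" for i
    using dpos[OF that] by (simp add: v_def d_def norm_eq_sqrt_inner[symmetric] power2_norm_eq_inner[symmetric] power2_eq_square)
  have vp: "inner (v i) (v j) < - 1 / 2" if ij: "i < 3" "j < 3" "i \<noteq> j" for i j
    using pair[OF ij] dpos[OF ij(1)] dpos[OF ij(2)] by (simp add: v_def field_simps)
  have "0 \<le> inner (v 0 + v 1 + v 2) (v 0 + v 1 + v 2)" by simp
  also have "\<dots> = inner (v 0) (v 0) + inner (v 1) (v 1) + inner (v 2) (v 2) +
      2 * inner (v 0) (v 1) + 2 * inner (v 0) (v 2) + 2 * inner (v 1) (v 2)"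
    by (simp add: inner_add inner_commute)
  also have "\<dots> < 0" using vv[of 0] vv[of 1] vv[of 2] vp[of 0 1] vp[of 0 2] vp[of 1 2] by simp
  finally show False by simp
qed

text \<open>The form of the preceding lemma for a family of discs that are disjoint when their radii are nonnegative.\<close>

lemma at_most_two_discs_near:
  fixes \<Lambda> :: "complex set" and \<rho> :: "complex \<Rightarrow> real"
  assumes "t > 0"
    and disj: "\<And>l l'. l \<in> \<Lambda> \<Longrightarrow> l' \<in> \<Lambda> \<Longrightarrow> l \<noteq> l' \<Longrightarrow> \<rho> l \<ge> 0 \<Longrightarrow> \<rho> l' \<ge> 0 \<Longrightarrow> cmod (l - l') \<ge> \<rho> l + \<rho> l'"
    and a: "a \<in> \<Lambda>" "\<rho> a \<ge> 10 * t" "cmod (w - a) \<le> \<rho> a + t"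
    and b: "b \<in> \<Lambda>" "\<rho> b \<ge> 10 * t" "cmod (w - b) \<le> \<rho> b + t"
    and c: "c \<in> \<Lambda>" "\<rho> c \<ge> 10 * t" "cmod (w - c) \<le> \<rho> c + t"
  shows "a = b \<or> a = c \<or> b = c"
proof (rule ccontr)
  assume ne: "\<not> ?thesis"
  let ?l = "\<lambda>i::nat. [a, b, c] ! i"
  have three: "i = 0 \<or> i = 1 \<or> i = 2" if "i < 3" for i :: nat using that by auto
  have nonneg: "\<rho> a \<ge> 0" "\<rho> b \<ge> 0" "\<rho> c \<ge> 0" using a b c \<open>t > 0\<close> by auto
  show False
  proof (rule three_almost_touching_discs[of t "\<lambda>i. \<rho> (?l i)" w ?l])
    fix i :: nat assume "i < 3"
    with three a b c show "10 * t \<le> \<rho> (?l i)" "cmod (w - ?l i) \<le> \<rho> (?l i) + t" by fastforce+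
  next
    fix i j :: nat assume ij: "i < 3" "j < 3" "i \<noteq> j"
    have "?l i \<in> \<Lambda>" "?l j \<in> \<Lambda>" "\<rho> (?l i) \<ge> 0" "\<rho> (?l j) \<ge> 0" "?l i \<noteq> ?l j"
      using three[OF ij(1)] three[OF ij(2)] ij(3) ne a(1) b(1) c(1) nonneg by auto
    thus "\<rho> (?l i) + \<rho> (?l j) \<le> cmod (?l i - ?l j)" using disj by blast
  qed (use \<open>t > 0\<close> in auto)
qed

text \<open>Discs that are disjoint, have radii tending to infinity and cover the plane after their radii are
  increased by \<open>t\<close> do not exist. The circle at distance \<open>t\<close> around one of them is covered by
  the open enlarged discs of the others. It is connected and no single other disc contains it, so two
  of them meet on it, and there three discs come within \<open>t\<close> of one point. All radii involved
  must be large compared with \<open>t\<close>, so the first disc has to be chosen such that its circle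
  avoids the bounded region where small discs may help to cover. A disc may be far
  away and yet reach close to the origin because it is huge, but at most two very large discs do
  so, by \<open>at_most_two_discs_near\<close>.\<close>

lemma disjoint_large_discs_leave_gaps:
  fixes \<Lambda> :: "complex set" and \<rho> :: "complex \<Rightarrow> real"
  assumes t: "t > 0"
    and disj: "\<And>l l'. l \<in> \<Lambda> \<Longrightarrow> l' \<in> \<Lambda> \<Longrightarrow> l \<noteq> l' \<Longrightarrow> \<rho> l \<ge> 0 \<Longrightarrow> \<rho> l' \<ge> 0 \<Longrightarrow> cmod (l - l') \<ge> \<rho> l + \<rho> l'"
    and cover: "\<And>z. \<exists>l\<in>\<Lambda>. cmod (z - l) < \<rho> l + t"
    and infty: "\<And>M. \<exists>R. \<forall>l\<in>\<Lambda>. cmod l > R \<longrightarrow> \<rho> l > M"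
  shows False
proof -
  have large: "\<exists>K>0. \<forall>z. cmod z > K \<longrightarrow> (\<forall>l\<in>\<Lambda>. cmod (z - l) < \<rho> l + t \<longrightarrow> \<rho> l > M)" if "M > 0" for M
  proof -
    obtain R where R: "\<forall>l\<in>\<Lambda>. cmod l > R \<longrightarrow> \<rho> l > M" using infty by blast
    show ?thesis
    proof (intro exI conjI allI ballI impI)
      show "max R 0 + M + t > 0" using that t by auto
      fix z l assume z: "cmod z > max R 0 + M + t" and l: "l \<in> \<Lambda>" "cmod (z - l) < \<rho> l + t"
      show "\<rho> l > M"
      proof (rule ccontr)
        assume "\<not> \<rho> l > M"
        moreover from this R l(1) have "cmod l \<le> R" by force
        moreover have "cmod z \<le> cmod (z - l) + cmod l" using norm_triangle_ineq[of "z - l" l] by simp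
        ultimately show False using z l(2) by linarith
      qed
    qed
  qed
  obtain K where K: "K > 0" "\<And>z l. cmod z > K \<Longrightarrow> l \<in> \<Lambda> \<Longrightarrow> cmod (z - l) < \<rho> l + t \<Longrightarrow> \<rho> l > 10 * t"
    using large[of "10 * t"] t by auto
  define t' where "t' = K + t"
  have t': "t' > 0" using K t by (simp add: t'_def)
  obtain K' where K': "K' > 0" "\<And>z l. cmod z > K' \<Longrightarrow> l \<in> \<Lambda> \<Longrightarrow> cmod (z - l) < \<rho> l + t \<Longrightarrow> \<rho> l > 10 * t'"
    using large[of "10 * t'"] t' by auto
  \<comment> \<open>at most two discs of radius beyond \<open>10 * t'\<close> come near the origin\<close>
  define N where "N = {l \<in> \<Lambda>. \<rho> l > 10 * t' \<and> cmod l \<le> \<rho> l + t'}"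
  have "finite N"
  proof -
    have "\<exists>a b. N \<subseteq> {a, b}"
    proof (rule ccontr)
      assume no: "\<nexists>a b. N \<subseteq> {a, b}"
      obtain a where a: "a \<in> N" using no by blast
      obtain b where b: "b \<in> N" "b \<noteq> a" using no by blast
      obtain c where c: "c \<in> N" "c \<noteq> a" "c \<noteq> b" using no by blast
      show False
        using at_most_two_discs_near[OF t' disj, of \<Lambda> a 0 b c] a b c by (auto simp: N_def)
    qed
    thus ?thesis by (meson finite.emptyI finite.insertI finite_subset)
  qed
  \<comment> \<open>The real point \<open>L\<close> lies outside the enlarged discs of \<open>N\<close>, so the disc that covers it stays away from the origin.\<close>
  define L where "L = K' + (\<Sum>l\<in>N. cmod l + (\<rho> l + t)) + 1"
  have pos: "cmod l + (\<rho> l + t) \<ge> 0" if "l \<in> N" for l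
    using that t t' by (auto simp: N_def intro!: add_nonneg_nonneg)
  have "(\<Sum>l\<in>N. cmod l + (\<rho> l + t)) \<ge> 0" using pos by (rule sum_nonneg)
  hence L: "L > K'" by (simp add: L_def)
  obtain a where a: "a \<in> \<Lambda>" "cmod (of_real L - a) < \<rho> a + t" using cover by blast
  have \<rho>a: "\<rho> a > 10 * t'" using K'(2)[of "of_real L" a] a L K'(1) by simp
  have "a \<notin> N"
  proof
    assume "a \<in> N"
    have "L \<le> cmod (of_real L - a) + cmod a"
      using norm_triangle_ineq[of "of_real L - a" a] L K'(1) by simp
    also have "\<dots> < cmod a + (\<rho> a + t)" using a by simp
    also have "\<dots> \<le> (\<Sum>l\<in>N. cmod l + (\<rho> l + t))"
      using pos \<open>a \<in> N\<close> \<open>finite N\<close> by (intro member_le_sum) auto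
    finally show False using K'(1) by (simp add: L_def)
  qed
  hence far: "cmod a > \<rho> a + t'" using a \<rho>a by (auto simp: N_def)
  define s where "s = \<rho> a + t"
  have s: "s > 0" using \<rho>a t t' by (simp add: s_def)
  have \<rho>a': "\<rho> a \<ge> 10 * t" using \<rho>a K(1) t by (simp add: t'_def)
  define D where "D l = ball l (\<rho> l + t)" for l
  define \<Lambda>' where "\<Lambda>' = {l \<in> \<Lambda>. l \<noteq> a \<and> \<rho> l > 10 * t}"
  have sphere_cover: "\<exists>l\<in>\<Lambda>'. w \<in> D l" if "w \<in> sphere a s" for w
  proof -
    have dist: "cmod (w - a) = s" using that by (simp add: dist_norm norm_minus_commute)
    obtain l where l: "l \<in> \<Lambda>" "cmod (w - l) < \<rho> l + t" using cover by blast
    have "cmod a \<le> cmod (w - a) + cmod w" using norm_triangle_ineq4[of w "w - a"] by simp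
    hence "cmod w > K" using far dist by (simp add: s_def t'_def)
    with K(2) l have "\<rho> l > 10 * t" by blast
    moreover have "l \<noteq> a" using l dist by (auto simp: s_def)
    ultimately show ?thesis using l by (auto simp: \<Lambda>'_def D_def dist_norm norm_minus_commute)
  qed
  have "a + of_real s \<in> sphere a s" using s by (simp add: dist_norm)
  then obtain b where b: "b \<in> \<Lambda>'" "a + of_real s \<in> D b" using sphere_cover by blast
  have not_sub: "\<not> sphere a s \<subseteq> D b"
  proof
    assume sub: "sphere a s \<subseteq> D b"
    define u where "u = (a - b) /\<^sub>R cmod (a - b)"
    have ab: "cmod (a - b) > 0" using b by (auto simp: \<Lambda>'_def)
    hence u: "cmod u = 1" "a - b = cmod (a - b) *\<^sub>R u" by (simp_all add: u_def)
    have "a + s *\<^sub>R u \<in> sphere a s" using u(1) s by (simp add: dist_norm)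
    hence "a + s *\<^sub>R u \<in> D b" using sub by blast
    hence "cmod (b - (a + s *\<^sub>R u)) < \<rho> b + t" by (simp add: D_def dist_norm)
    moreover have "b - (a + s *\<^sub>R u) = - ((cmod (a - b) + s) *\<^sub>R u)"
      using u(2) by (simp add: algebra_simps)
    hence "cmod (b - (a + s *\<^sub>R u)) = cmod (a - b) + s"
      using u(1) s by simp
    moreover have "cmod (a - b) \<ge> \<rho> a + \<rho> b"
      using b a(1) \<rho>a' t by (intro disj) (auto simp: \<Lambda>'_def)
    ultimately show False using \<rho>a' t by (simp add: s_def)
  qed
  have "D b \<inter> (\<Union>l\<in>\<Lambda>' - {b}. D l) \<inter> sphere a s \<noteq> {}"
  proof
    assume empty: "D b \<inter> (\<Union>l\<in>\<Lambda>' - {b}. D l) \<inter> sphere a s = {}"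
    have conn: "connected (sphere a s)" by (rule connected_sphere) simp
    have union: "sphere a s \<subseteq> D b \<union> (\<Union>l\<in>\<Lambda>' - {b}. D l)" using sphere_cover by blast
    have "D b \<inter> sphere a s = {} \<or> (\<Union>l\<in>\<Lambda>' - {b}. D l) \<inter> sphere a s = {}"
      by (rule connectedD[OF conn _ _ empty union]) (auto simp: D_def)
    moreover have "D b \<inter> sphere a s \<noteq> {}" using b(2) \<open>a + of_real s \<in> sphere a s\<close> by blast
    ultimately show False using union not_sub by blast
  qed
  then obtain w c where w: "w \<in> sphere a s" "w \<in> D b" "w \<in> D c" and c: "c \<in> \<Lambda>'" "c \<noteq> b" by blast
  have "a = b \<or> a = c \<or> b = c"
    using at_most_two_discs_near[OF t disj, of \<Lambda> a w b c] a(1) \<rho>a' b(1) c(1) w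
    by (auto simp: \<Lambda>'_def D_def s_def dist_norm norm_minus_commute)
  thus False using b(1) c by (auto simp: \<Lambda>'_def)
qed

section \<open>Incompatibility of sampling and interpolation\<close>

theorem corollary3:
  fixes \<alpha> :: real and \<Lambda> :: "complex set" and m :: "complex \<Rightarrow> nat"
  assumes "\<alpha> > 0"
    and "divisor \<Lambda> m"
    and "multiplicities_tend_to_infinity \<Lambda> m"
  shows "\<not> (interpolating \<alpha> \<Lambda> m \<and> sampling \<alpha> \<Lambda> m)"
proof
  assume *: "interpolating \<alpha> \<Lambda> m \<and> sampling \<alpha> \<Lambda> m"
  define r where "r l = sqrt (real (m l) / \<alpha>)" for l
  obtain C where C: "C > 0" and cover: "\<And>z. \<exists>l\<in>\<Lambda>. cmod (z - l) < r l + C"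
    using sampling_imp_cover[OF assms(1,2)] * unfolding r_def by metis
  obtain C' where C': "C' > 0" and disj: "\<And>l l' z. l \<in> \<Lambda> \<Longrightarrow> l' \<in> \<Lambda> \<Longrightarrow> l \<noteq> l' \<Longrightarrow>
    cmod (z - l) \<le> r l - C' \<Longrightarrow> cmod (z - l') \<le> r l' - C' \<Longrightarrow> False"
    using complete_interpolating_imp_disjoint[OF assms(1,2)] * unfolding r_def by metis
  show False
  proof (rule disjoint_large_discs_leave_gaps[of "C + C'" \<Lambda> "\<lambda>l. r l - C'"])
    show "C + C' > 0" using C C' by simp
  next
    fix l l' assume l: "l \<in> \<Lambda>" "l' \<in> \<Lambda>" "l \<noteq> l'" and nonneg: "r l - C' \<ge> 0" "r l' - C' \<ge> 0"
    show "r l - C' + (r l' - C') \<le> cmod (l - l')"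
    proof (rule ccontr)
      assume "\<not> ?thesis"
      hence less: "cmod (l' - l) < (r l - C') + (r l' - C')" by (simp add: norm_minus_commute)
      define d where "d = cmod (l' - l)"
      have d: "d > 0" using l by (simp add: d_def)
      \<comment> \<open>The point at parameter \<open>t\<close> of the segment from \<open>l\<close> to \<open>l'\<close> lies in both discs.\<close>
      define t where "t = min d (r l - C') / d"
      have td: "t * d = min d (r l - C')" using d by (simp add: t_def)
      have "t \<ge> 0" "t \<le> 1" using d nonneg by (simp_all add: t_def)
      moreover have "(1 - t) * d = d - t * d" by (simp add: algebra_simps)
      ultimately have t: "0 \<le> t" "t \<le> 1" "t * d \<le> r l - C'" "(1 - t) * d \<le> r l' - C'"
        using nonneg less unfolding d_def[symmetric] td by auto
      have "cmod (l + of_real t * (l' - l) - l) \<le> r l - C'"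
        using t by (simp add: norm_mult d_def)
      moreover have "l + of_real t * (l' - l) - l' = - (of_real (1 - t) * (l' - l))"
        by (simp add: algebra_simps)
      hence "cmod (l + of_real t * (l' - l) - l') = (1 - t) * d"
        using t by (simp only: norm_minus_cancel norm_mult norm_of_real d_def)
      hence "cmod (l + of_real t * (l' - l) - l') \<le> r l' - C'" using t by simp
      ultimately show False using disj[OF l] by blast
    qed
  next
    fix z show "\<exists>l\<in>\<Lambda>. cmod (z - l) < r l - C' + (C + C')" using cover[of z] by simp
  next
    fix M :: real
    define M' where "M' = \<alpha> * (\<bar>M\<bar> + C')\<^sup>2"
    have "M' > 0" using assms(1) C' by (simp add: M'_def)
    then obtain R where R: "\<forall>l\<in>\<Lambda>. cmod l > R \<longrightarrow> real (m l) > M'"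
      using assms(3) unfolding multiplicities_tend_to_infinity_def by blast
    have "r l - C' > M" if "real (m l) > M'" for l
    proof -
      have "(\<bar>M\<bar> + C')\<^sup>2 < real (m l) / \<alpha>" using that assms(1) by (simp add: M'_def field_simps)
      hence "\<bar>M\<bar> + C' < r l" unfolding r_def by (rule real_less_rsqrt)
      thus ?thesis by linarith
    qed
    thus "\<exists>R. \<forall>l\<in>\<Lambda>. cmod l > R \<longrightarrow> r l - C' > M" using R by blast
  qed
qed

end
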